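(* Let $(\Omega,\mathcal F,P)$ be a probability space with $L_2(\Omega,\mathcal F,P)$ separable, let $\Lambda$ be the lattice of all sub-$\sigma$-fields of $\mathcal F$ (each containing all null sets), and let $B\subset\Lambda$ be a noise-type Boolean algebra. Then $B$ has a noise-type completion; that is, among all noise-type Boolean algebras $C\subset\Lambda$ such that $B\subset C$ and $B$ is monotonically dense in $C$ there is a greatest one (with respect to inclusion).
   Context: Every sub-$\sigma$-field of $\mathcal F$ is assumed to contain all null sets of $\mathcal F$. $\Lambda$ is ordered by inclusion; it is a lattice with $\mathcal E_1\wedge\mathcal E_2=\mathcal E_1\cap\mathcal E_2$ and $\mathcal E_1\vee\mathcal E_2$ the least $\sigma$-field containing both $\mathcal E_1$ and $\mathcal E_2$. The trivial $\sigma$-field consists of the null sets and their complements only. Two $\sigma$-fields $\mathcal E_1,\mathcal E_2$ are independent if $P(X\cap Y)=P(X)P(Y)$ for all $X\in\mathcal E_1$, $Y\in\mathcal E_2$. A noise-type Boolean algebra is a sublattice $B$ of $\Lambda$, containing the trivial $\sigma$-field and the whole $\mathcal F$, such that $B$ (with the induced lattice operations) is a Boolean algebra (a distributive lattice in which every element has a complement in $B$), and any two $\sigma$-fields of $B$ are independent whenever their intersection is the trivial $\sigma$-field. A subset $Z\subset\Lambda$ is monotonically closed if $Z$ contains $\bigcap_n\mathcal E_n$ for every decreasing sequence of $\sigma$-fields $\mathcal E_n\in Z$, and $Z$ contains $\bigvee_n\mathcal E_n$ (the least $\sigma$-field containing all $\mathcal E_n$) for every increasing sequence of $\sigma$-fields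 $\mathcal E_n\in Z$. For noise-type Boolean algebras $B_1\subset B_2\subset\Lambda$, $B_1$ is monotonically dense in $B_2$ if every monotonically closed subset of $\Lambda$ containing $B_1$ contains also $B_2$. *)

theory Defs
  imports "HOL-Probability.Probability"
begin

text \<open>
  Elements of \<open>L\<^sub>2\<close> are represented by square-integrable measurable functions (not by their
  classes modulo null sets), so \<open>L2_dist\<close> is only a pseudometric. This does not affect
  separability: a countable dense set of classes is the same thing as a countable dense set of
  representatives. Real scalars are used.
\<close>

definition L2_space :: "'a measure \<Rightarrow> ('a \<Rightarrow> real) set" where
  "L2_space M = {f \<in> borel_measurable M. integrable M (\<lambda>x. (f x)\<^sup>2)}"

definition L2_dist :: "'a measure \<Rightarrow> ('a \<Rightarrow> real) \<Rightarrow> ('a \<Rightarrow> real) \<Rightarrow> real" where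
  "L2_dist M f g = sqrt (\<integral>x. (f x - g x)\<^sup>2 \<partial>M)"

definition separable_L2 :: "'a measure \<Rightarrow> bool" where
  "separable_L2 M \<longleftrightarrow>
    (\<exists>D. countable D \<and> D \<subseteq> L2_space M \<and>
      (\<forall>f\<in>L2_space M. \<forall>e>0. \<exists>d\<in>D. L2_dist M f d < e))"

text \<open>
  Sub-\<open>\<sigma>\<close>-fields are represented by their sets of members. Their lattice order is \<open>(\<subseteq>)\<close> and
  the meet is \<open>(\<inter>)\<close>. The measure is not required to be complete: \<open>null_sets M\<close> consists of
  the measurable sets of measure 0.
\<close>

definition sub_sigma_fields :: "'a measure \<Rightarrow> 'a set set set" where
  "sub_sigma_fields M =
    {E. sigma_algebra (space M) E \<and> E \<subseteq> sets M \<and> null_sets M \<subseteq> E}"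

definition sf_join :: "'a measure \<Rightarrow> 'a set set \<Rightarrow> 'a set set \<Rightarrow> 'a set set" where
  "sf_join M E F = sigma_sets (space M) (E \<union> F)"

definition trivial_sf :: "'a measure \<Rightarrow> 'a set set" where
  "trivial_sf M = {A \<in> sets M. A \<in> null_sets M \<or> space M - A \<in> null_sets M}"

definition noise_type_boolean_algebra :: "'a measure \<Rightarrow> 'a set set set \<Rightarrow> bool" where
  "noise_type_boolean_algebra M B \<longleftrightarrow>
    B \<subseteq> sub_sigma_fields M \<and>
    trivial_sf M \<in> B \<and> sets M \<in> B \<and>
    (\<forall>E\<in>B. \<forall>F\<in>B. E \<inter> F \<in> B) \<and>
    (\<forall>E\<in>B. \<forall>F\<in>B. sf_join M E F \<in> B) \<and>
    (\<forall>E\<in>B. \<forall>F\<in>B. \<forall>G\<in>B. E \<inter> sf_join M F G = sf_join M (E \<inter> F) (E \<inter> G)) \<and>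
    (\<forall>E\<in>B. \<exists>F\<in>B. E \<inter> F = trivial_sf M \<and> sf_join M E F = sets M) \<and>
    (\<forall>E\<in>B. \<forall>F\<in>B. E \<inter> F = trivial_sf M \<longrightarrow> prob_space.indep_set M E F)"

definition monotonically_closed :: "'a measure \<Rightarrow> 'a set set set \<Rightarrow> bool" where
  "monotonically_closed M Z \<longleftrightarrow>
    Z \<subseteq> sub_sigma_fields M \<and>
    (\<forall>E :: nat \<Rightarrow> 'a set set. range E \<subseteq> Z \<and> decseq E \<longrightarrow> (\<Inter>n. E n) \<in> Z) \<and>
    (\<forall>E :: nat \<Rightarrow> 'a set set. range E \<subseteq> Z \<and> incseq E \<longrightarrow>
      sigma_sets (space M) (\<Union>n. E n) \<in> Z)"

definition monotonically_dense ::
    "'a measure \<Rightarrow> 'a set set set \<Rightarrow> 'a set set set \<Rightarrow> bool" where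
  "monotonically_dense M B1 B2 \<longleftrightarrow>
    (\<forall>Z. monotonically_closed M Z \<and> B1 \<subseteq> Z \<longrightarrow> B2 \<subseteq> Z)"

definition monotonically_dense_extensions ::
    "'a measure \<Rightarrow> 'a set set set \<Rightarrow> 'a set set set set" where
  "monotonically_dense_extensions M B =
    {C. noise_type_boolean_algebra M C \<and> B \<subseteq> C \<and> monotonically_dense M B C}"

definition noise_type_completion ::
    "'a measure \<Rightarrow> 'a set set set \<Rightarrow> 'a set set set \<Rightarrow> bool" where
  "noise_type_completion M B C \<longleftrightarrow>
    C \<in> monotonically_dense_extensions M B \<and>
    (\<forall>D\<in>monotonically_dense_extensions M B. D \<subseteq> C)"

end

theory Submission
  imports Defs
begin

text \<open>
  Let \<open>Z\<close> be the least monotonically closed set containing \<open>B\<close>; monotone density of \<open>B\<close> in \<open>D\<close>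
  means \<open>D \<subseteq> Z\<close>. The completion consists of the elements of \<open>Z\<close> that have a complement in \<open>Z\<close>;
  it obviously contains every other candidate, and the work is to see that it is a noise-type
  Boolean algebra. Conditional expectations given two members of \<open>B\<close> commute. This passes to
  monotone limits, so \<open>Z\<close> is closed under intersection, its elements commute, and those with
  trivial intersection are independent. Joins are not continuous in general, but
  \<open>\<Inter>\<^sub>n (U\<^sub>n \<or> V) = (\<Inter>\<^sub>n U\<^sub>n) \<or> V\<close> if all \<open>U\<^sub>n\<close> lie in one \<open>\<sigma>\<close>-field independent of \<open>V\<close>. Hence a
  complementary pair \<open>x, x'\<close> in \<open>Z\<close> splits each \<open>z\<close> in \<open>Z\<close> as \<open>(z \<and> x) \<or> (z \<and> x')\<close>, and
  \<open>x \<or> z\<close> stays in \<open>Z\<close>; the Boolean algebra laws follow. No convergence theorem for conditional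
  expectations is needed: one only asks with respect to which \<open>\<sigma>\<close>-fields they are measurable.
\<close>

subsection \<open>Conditional probabilities given sub-\<open>\<sigma>\<close>-fields\<close>

text \<open>Dynkin's pi-lambda argument: the sets over which the two integrals agree are closed
  under disjoint countable unions, and under complements because \<open>space M\<close> lies in
  \<open>S\<close>, which makes the total integrals equal.\<close>

lemma integral_eq_on_generated:
  fixes f g :: "'a \<Rightarrow> real"
  assumes S: "Int_stable S" "S \<subseteq> sets M" "space M \<in> S"
    and int: "integrable M f" "integrable M g"
    and eq: "\<And>A. A \<in> S \<Longrightarrow> (\<integral>x. indicator A x * f x \<partial>M) = (\<integral>x. indicator A x * g x \<partial>M)"
    and A: "A \<in> sigma_sets (space M) S"
  shows "(\<integral>x. indicator A x * f x \<partial>M) = (\<integral>x. indicator A x * g x \<partial>M)"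
proof -
  have sub: "S \<subseteq> Pow (space M)"
    using S(2) sets.space_closed by blast
  have sM: "B \<in> sets M" if "B \<in> sigma_sets (space M) S" for B
    using that S(2) sets.sigma_sets_subset by blast
  have int_compl: "(\<integral>x. indicator (space M - B) x * h x \<partial>M)
      = (\<integral>x. h x \<partial>M) - (\<integral>x. indicator B x * h x \<partial>M)"
    if "B \<in> sets M" "integrable M h" for B and h :: "'a \<Rightarrow> real"
  proof -
    have "(\<integral>x. indicator (space M - B) x * h x \<partial>M) = (\<integral>x. h x - indicator B x * h x \<partial>M)"
      by (rule Bochner_Integration.integral_cong) (auto simp: indicator_def)
    then show ?thesis
      using that integrable_mult_indicator[of B M h] by simp
  qed
  have int_union: "(\<integral>x. indicator (\<Union>i. B i) x * h x \<partial>M) = (\<Sum>i. \<integral>x. indicator (B i) x * h x \<partial>M)"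
    if "disjoint_family B" "range B \<subseteq> sets M" "integrable M h"
    for B :: "nat \<Rightarrow> 'a set" and h :: "'a \<Rightarrow> real"
  proof -
    have "(LINT x:(\<Union>i. B i)|M. h x) = (\<Sum>i. (LINT x:(B i)|M. h x))"
      using that by (intro lebesgue_integral_countable_add)
        (auto simp: disjoint_family_on_def set_integrable_def intro!: integrable_mult_indicator[of _ M h, simplified])
    then show ?thesis
      by (simp add: set_lebesgue_integral_def)
  qed
  have sp: "(\<integral>x. f x \<partial>M) = (\<integral>x. g x \<partial>M)"
  proof -
    have "(\<integral>x. h x \<partial>M) = (\<integral>x. indicator (space M) x * h x \<partial>M)" for h :: "'a \<Rightarrow> real"
      by (rule Bochner_Integration.integral_cong) auto
    then show ?thesis
      using eq[OF S(3)] by metis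
  qed
  show ?thesis
    using S(1) sub A
  proof (induction rule: sigma_sets_induct_disjoint)
    case (compl B)
    with sM[of B] sp int show ?case by (simp add: int_compl)
  next
    case (union B)
    then have "range B \<subseteq> sets M" using sM by blast
    then show ?case using union int by (simp add: int_union)
  qed (use eq in auto)
qed

context prob_space
begin

text \<open>The measure carried by \<open>sigma (space M) E\<close> is zero, but
  \<open>real_cond_exp\<close> uses only its space and its sets.\<close>

abbreviation (input) sf_cond_prob :: "'a set set \<Rightarrow> 'a set \<Rightarrow> 'a \<Rightarrow> real" where
  "sf_cond_prob E A \<equiv> real_cond_exp M (sigma (space M) E) (indicator A)"

text \<open>All that \<open>Y\<close> knows about \<open>A\<close> is contained in \<open>W\<close>.
  For \<open>W\<close> in \<open>sub_sigma_fields M\<close> the choice of version is immaterial,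
  since \<open>W\<close> contains the null sets. Asking for measurability instead of an equation
  between conditional expectations makes the passage to intersections of such \<open>W\<close>
  elementary.\<close>

definition cond_prob_measurable :: "'a set set \<Rightarrow> 'a set set \<Rightarrow> 'a set \<Rightarrow> bool" where
  "cond_prob_measurable Y W A \<longleftrightarrow> sf_cond_prob Y A \<in> borel_measurable (sigma (space M) W)"

text \<open>For sub-sigma-fields this is commutation of the two conditional expectations, in the
  one-sided form that conditioning on \<open>Y\<close> preserves \<open>X\<close>-measurability. The
  symmetry is \<open>sf_commute_sym\<close>.\<close>

definition sf_commute :: "'a set set \<Rightarrow> 'a set set \<Rightarrow> bool" where
  "sf_commute X Y \<longleftrightarrow> (\<forall>A\<in>X. cond_prob_measurable Y X A)"

section \<open>The lattice of sub-sigma-fields\<close>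

lemma sub_sigma_fieldsD:
  assumes "E \<in> sub_sigma_fields M"
  shows "sigma_algebra (space M) E" "E \<subseteq> sets M" "null_sets M \<subseteq> E"
    "sigma_finite_subalgebra M (sigma (space M) E)"
    "sets (sigma (space M) E) = E" "space (sigma (space M) E) = space M" "space M \<in> E"
proof -
  show 1: "sigma_algebra (space M) E" "E \<subseteq> sets M" "null_sets M \<subseteq> E"
    using assms by (auto simp: sub_sigma_fields_def)
  interpret E: sigma_algebra "space M" E by fact
  show "sets (sigma (space M) E) = E" "space (sigma (space M) E) = space M" "space M \<in> E"
    by auto
  then show "sigma_finite_subalgebra M (sigma (space M) E)"
    using 1(2) by (intro finite_measure_subalgebra_is_sigma_finite)
      (auto simp: finite_measure_subalgebra_def finite_measure_subalgebra_axioms_def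
        subalgebra_def finite_measure_axioms)
qed

lemma sub_sigma_fields_Inter:
  assumes "I \<noteq> {}" "\<And>i. i \<in> I \<Longrightarrow> E i \<in> sub_sigma_fields M"
  shows "(\<Inter>i\<in>I. E i) \<in> sub_sigma_fields M"
proof -
  obtain i where i: "i \<in> I" using assms(1) by blast
  have E: "{} \<in> E j" "null_sets M \<subseteq> E j" "E j \<subseteq> sets M"
    "\<And>A. A \<in> E j \<Longrightarrow> space M - A \<in> E j"
    "\<And>A :: nat \<Rightarrow> 'a set. range A \<subseteq> E j \<Longrightarrow> (\<Union>i. A i) \<in> E j" if "j \<in> I" for j
    using assms(2)[OF that] unfolding sub_sigma_fields_def sigma_algebra_iff2 by simp_all
  have "(\<Inter>i\<in>I. E i) \<subseteq> sets M"
    using E(3)[OF i] i by blast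
  moreover from this have "sigma_algebra (space M) (\<Inter>i\<in>I. E i)"
    unfolding sigma_algebra_iff2
  proof (intro conjI allI impI ballI)
    show "(\<Inter>i\<in>I. E i) \<subseteq> Pow (space M)" if "(\<Inter>i\<in>I. E i) \<subseteq> sets M"
      using that sets.space_closed by blast
    show "{} \<in> (\<Inter>i\<in>I. E i)" using E(1) by blast
    show "space M - A \<in> (\<Inter>i\<in>I. E i)" if "A \<in> (\<Inter>i\<in>I. E i)" for A
      using that E(4) by blast
    show "(\<Union>n. A n) \<in> (\<Inter>i\<in>I. E i)" if "range A \<subseteq> (\<Inter>i\<in>I. E i)" for A :: "nat \<Rightarrow> 'a set"
    proof (rule INT_I)
      fix j assume "j \<in> I"
      with that have "range A \<subseteq> E j" by blast
      with E(5)[OF \<open>j \<in> I\<close>] show "(\<Union>n. A n) \<in> E j" .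
    qed
  qed
  moreover have "null_sets M \<subseteq> (\<Inter>i\<in>I. E i)"
    using E(2) by blast
  ultimately show ?thesis
    unfolding sub_sigma_fields_def by blast
qed

lemma sub_sigma_fields_Int:
  assumes "E \<in> sub_sigma_fields M" "F \<in> sub_sigma_fields M"
  shows "E \<inter> F \<in> sub_sigma_fields M"
proof -
  have "(\<Inter>i\<in>{E, F}. i) \<in> sub_sigma_fields M"
    by (rule sub_sigma_fields_Inter) (use assms in auto)
  then show ?thesis by simp
qed

lemma sub_sigma_fields_sigma_sets:
  assumes "S \<subseteq> sets M" "null_sets M \<subseteq> S"
  shows "sigma_sets (space M) S \<in> sub_sigma_fields M"
proof -
  have "S \<subseteq> Pow (space M)"
    using assms(1) sets.space_closed by blast
  then show ?thesis
    using assms sigma_algebra_sigma_sets[of S] sets.sigma_sets_subset[of S M]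
      sigma_sets_superset_generator[of S "space M"]
    unfolding sub_sigma_fields_def by blast
qed

lemma sf_join_sub_sigma_fields:
  assumes "E \<in> sub_sigma_fields M" "F \<in> sub_sigma_fields M"
  shows "sf_join M E F \<in> sub_sigma_fields M"
  unfolding sf_join_def using assms[THEN sub_sigma_fieldsD(2)] sub_sigma_fieldsD(3)[OF assms(1)]
  by (intro sub_sigma_fields_sigma_sets) blast+

lemma sf_join_upper: "E \<subseteq> sf_join M E F" "F \<subseteq> sf_join M E F"
  by (auto simp: sf_join_def)

lemma sf_join_least:
  assumes "G \<in> sub_sigma_fields M" "E \<subseteq> G" "F \<subseteq> G"
  shows "sf_join M E F \<subseteq> G"
  unfolding sf_join_def
  using assms(2,3) by (intro sigma_algebra.sigma_sets_subset[OF sub_sigma_fieldsD(1)[OF assms(1)]]) simp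

lemma sf_join_mono: "E \<subseteq> E' \<Longrightarrow> F \<subseteq> F' \<Longrightarrow> sf_join M E F \<subseteq> sf_join M E' F'"
  unfolding sf_join_def by (intro sigma_sets_subseteq) auto

lemma sf_join_commute: "sf_join M E F = sf_join M F E"
  by (simp add: sf_join_def Un_commute)

text \<open>The union \<open>E \<union> F\<close> need not be stable under intersection; the sets
  \<open>A \<inter> B\<close> give a generator that is, as pi-lambda arguments require.\<close>

lemma sigma_sets_eq_sf_join:
  assumes "E \<in> sub_sigma_fields M" "F \<in> sub_sigma_fields M"
  shows "sigma_sets (space M) {A \<inter> B |A B. A \<in> E \<and> B \<in> F} = sf_join M E F"
proof (rule antisym)
  interpret J: sigma_algebra "space M" "sf_join M E F"
    by (intro sub_sigma_fieldsD(1) sf_join_sub_sigma_fields assms)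
  show "sigma_sets (space M) {A \<inter> B |A B. A \<in> E \<and> B \<in> F} \<subseteq> sf_join M E F"
  proof (rule J.sigma_sets_subset, safe)
    fix A B assume "A \<in> E" "B \<in> F"
    then show "A \<inter> B \<in> sf_join M E F"
      using sf_join_upper(1)[of E F] sf_join_upper(2)[of F E] by (intro J.Int) auto
  qed
  have "A \<in> {A \<inter> B |A B. A \<in> E \<and> B \<in> F}" if "A \<in> E \<union> F" for A
  proof -
    have "A = A \<inter> space M" "A = space M \<inter> A"
      using that assms[THEN sub_sigma_fieldsD(2)] sets.sets_into_space by blast+
    then show ?thesis
      using that assms[THEN sub_sigma_fieldsD(7)] by blast
  qed
  then show "sf_join M E F \<subseteq> sigma_sets (space M) {A \<inter> B |A B. A \<in> E \<and> B \<in> F}"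
    unfolding sf_join_def by (intro sigma_sets_subseteq) blast
qed

lemma Int_stable_Int:
  assumes "E \<in> sub_sigma_fields M" "F \<in> sub_sigma_fields M"
  shows "Int_stable {A \<inter> B |A B. A \<in> E \<and> B \<in> F}"
proof (rule Int_stableI, safe)
  interpret E: sigma_algebra "space M" E by (rule sub_sigma_fieldsD(1)[OF assms(1)])
  interpret F: sigma_algebra "space M" F by (rule sub_sigma_fieldsD(1)[OF assms(2)])
  fix A B A' B' assume "A \<in> E" "A' \<in> E" "B \<in> F" "B' \<in> F"
  then have "A \<inter> A' \<in> E" "B \<inter> B' \<in> F" "A \<inter> B \<inter> (A' \<inter> B') = A \<inter> A' \<inter> (B \<inter> B')"
    by auto
  then show "\<exists>Aa Ba. A \<inter> B \<inter> (A' \<inter> B') = Aa \<inter> Ba \<and> Aa \<in> E \<and> Ba \<in> F"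
    by blast
qed

lemma sf_join_integral_eq:
  fixes f g :: "'a \<Rightarrow> real"
  assumes E: "E \<in> sub_sigma_fields M" "F \<in> sub_sigma_fields M"
    and int: "integrable M f" "integrable M g"
    and eq: "\<And>A B. A \<in> E \<Longrightarrow> B \<in> F \<Longrightarrow>
      (\<integral>x. indicator (A \<inter> B) x * f x \<partial>M) = (\<integral>x. indicator (A \<inter> B) x * g x \<partial>M)"
    and A: "A \<in> sf_join M E F"
  shows "(\<integral>x. indicator A x * f x \<partial>M) = (\<integral>x. indicator A x * g x \<partial>M)"
proof (rule integral_eq_on_generated[OF Int_stable_Int[OF E] _ _ int])
  show "A \<in> sigma_sets (space M) {A \<inter> B |A B. A \<in> E \<and> B \<in> F}"
    using A sigma_sets_eq_sf_join[OF E] by simp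
  show "space M \<in> {A \<inter> B |A B. A \<in> E \<and> B \<in> F}"
    using E[THEN sub_sigma_fieldsD(7)] by blast
  show "{A \<inter> B |A B. A \<in> E \<and> B \<in> F} \<subseteq> sets M"
    using E[THEN sub_sigma_fieldsD(2)] by blast
qed (use eq in auto)

section \<open>Measurability and conditional probabilities\<close>

lemma integrable_indicator_prob: "A \<in> sets M \<Longrightarrow> integrable M (indicator A :: 'a \<Rightarrow> real)"
  by (simp add: integrable_real_indicator emeasure_finite less_top[symmetric])

lemma integrable_sf_cond_prob:
  assumes "E \<in> sub_sigma_fields M" "A \<in> sets M"
  shows "integrable M (sf_cond_prob E A)"
proof -
  interpret sigma_finite_subalgebra M "sigma (space M) E"
    using sub_sigma_fieldsD(4) assms by blast
  show ?thesis
    using assms by (intro real_cond_exp_int integrable_indicator_prob)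
qed

lemma measurable_sf_mono:
  assumes "E \<in> sub_sigma_fields M" "F \<in> sub_sigma_fields M" "E \<subseteq> F"
    and "f \<in> borel_measurable (sigma (space M) E)"
  shows "f \<in> borel_measurable (sigma (space M) F)"
  using assms(3,4) by (auto simp: measurable_def sub_sigma_fieldsD[OF assms(1)] sub_sigma_fieldsD[OF assms(2)])

lemma measurable_sf_M:
  assumes "E \<in> sub_sigma_fields M" "f \<in> borel_measurable (sigma (space M) E)"
  shows "f \<in> borel_measurable M"
  using assms(2) sub_sigma_fieldsD(2,5,6)[OF assms(1)] by (auto simp: measurable_def)

text \<open>The preimages under \<open>f\<close> and \<open>g\<close> differ by null sets, and these
  belong to \<open>E\<close>.\<close>

lemma measurable_sf_AE:
  fixes f g :: "'a \<Rightarrow> real"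
  assumes E: "E \<in> sub_sigma_fields M" and g: "g \<in> borel_measurable (sigma (space M) E)"
    and f: "f \<in> borel_measurable M" and eq: "AE x in M. f x = g x"
  shows "f \<in> borel_measurable (sigma (space M) E)"
proof (rule measurableI)
  interpret E: sigma_algebra "space M" E by (rule sub_sigma_fieldsD(1)[OF E])
  have gM: "g \<in> borel_measurable M" using measurable_sf_M[OF E g] .
  fix S :: "real set" assume S: "S \<in> sets borel"
  let ?f = "f -` S \<inter> space M" and ?g = "g -` S \<inter> space M"
  have g1: "?g \<in> E" using measurable_sets[OF g S] E by (simp add: sub_sigma_fieldsD)
  have m: "?f \<in> sets M" "?g \<in> sets M" using measurable_sets f gM S by blast+
  have ae: "AE x in M. x \<notin> ?f - ?g" "AE x in M. x \<notin> ?g - ?f"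
    using eq by (auto elim!: eventually_mono)
  then have "?f - ?g \<in> null_sets M" "?g - ?f \<in> null_sets M"
    using m by (auto simp: AE_iff_null_sets)
  then have d: "?f - ?g \<in> E" "?g - ?f \<in> E"
    using sub_sigma_fieldsD(3)[OF E] by auto
  have "(?g - (?g - ?f)) \<union> (?f - ?g) \<in> E"
    by (intro E.Un E.Diff[OF g1 d(2)] d(1))
  also have "(?g - (?g - ?f)) \<union> (?f - ?g) = ?f" by blast
  finally show "f -` S \<inter> space (sigma (space M) E) \<in> sets (sigma (space M) E)"
    using E by (simp add: sub_sigma_fieldsD)
qed simp

lemma indicator_measurable_sf:
  assumes "E \<in> sub_sigma_fields M" "A \<in> sets M"
    and "(indicator A :: 'a \<Rightarrow> real) \<in> borel_measurable (sigma (space M) E)"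
  shows "A \<in> E"
proof -
  have "A = (indicator A :: 'a \<Rightarrow> real) -` {1} \<inter> space M"
    using sets.sets_into_space[OF assms(2)] by (auto simp: indicator_def)
  also have "\<dots> \<in> E"
    using measurable_sets[OF assms(3), of "{1}"] assms(1) by (simp add: sub_sigma_fieldsD)
  finally show ?thesis .
qed

lemma measurable_indicator_sf:
  assumes "E \<in> sub_sigma_fields M" "A \<in> E"
  shows "(indicator A :: 'a \<Rightarrow> real) \<in> borel_measurable (sigma (space M) E)"
  using assms by (intro borel_measurable_indicator) (simp add: sub_sigma_fieldsD)

lemma sf_cond_prob_AE_eqI:
  assumes E: "E \<in> sub_sigma_fields M" and A: "A \<in> sets M"
    and g: "integrable M g" "g \<in> borel_measurable (sigma (space M) E)"
    and eq: "\<And>D. D \<in> E \<Longrightarrow>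
      (\<integral>x. indicator D x * indicator A x \<partial>M) = (\<integral>x. indicator D x * g x \<partial>M)"
  shows "AE x in M. sf_cond_prob E A x = g x"
proof -
  interpret sigma_finite_subalgebra M "sigma (space M) E"
    using sub_sigma_fieldsD(4) E by blast
  show ?thesis
    using eq E A g by (intro real_cond_exp_charact)
      (auto simp: set_lebesgue_integral_def sub_sigma_fieldsD integrable_indicator_prob)
qed

text \<open>Both sides equal the integral of the product of the two conditional probabilities given
  \<open>W\<close>.\<close>

lemma sf_cond_prob_self_adjoint:
  assumes W: "W \<in> sub_sigma_fields M" and A: "A \<in> sets M" and D: "D \<in> sets M"
  shows "(\<integral>x. indicator A x * sf_cond_prob W D x \<partial>M) = (\<integral>x. indicator D x * sf_cond_prob W A x \<partial>M)"
proof -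
  interpret W: sigma_finite_subalgebra M "sigma (space M) W"
    using sub_sigma_fieldsD(4) W by blast
  have "(\<integral>x. sf_cond_prob W B x * sf_cond_prob W C x \<partial>M) = (\<integral>x. indicator C x * sf_cond_prob W B x \<partial>M)"
    if "B \<in> sets M" "C \<in> sets M" for B C
    using integrable_mult_indicator[OF that(2) integrable_sf_cond_prob[OF W that(1)]] that(2)
    by (subst W.real_cond_exp_intg(2)) (auto simp: mult.commute)
  from this[OF A D] this[OF D A] show ?thesis
    by (simp add: mult.commute)
qed

text \<open>Both sides express that conditioning \<open>A\<close> on \<open>Y\<close> and on
  \<open>W\<close> gives the same result. Self-adjointness shifts the conditioning from
  \<open>A\<close> to the test set \<open>D\<close>, so the right-hand side compares integrals over
  \<open>A\<close> of functions that do not depend on \<open>A\<close>. This form suits pi-lambda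
  arguments in \<open>A\<close>.\<close>

lemma cond_prob_measurable_iff:
  assumes Y: "Y \<in> sub_sigma_fields M" and W: "W \<in> sub_sigma_fields M" "W \<subseteq> Y"
    and A: "A \<in> sets M"
  shows "cond_prob_measurable Y W A \<longleftrightarrow> (\<forall>D\<in>Y. (\<integral>x. indicator A x * sf_cond_prob W D x \<partial>M)
      = (\<integral>x. indicator A x * indicator D x \<partial>M))" (is "?l \<longleftrightarrow> ?r")
proof -
  interpret Y: sigma_finite_subalgebra M "sigma (space M) Y"
    using sub_sigma_fieldsD(4) Y by blast
  interpret W: sigma_finite_subalgebra M "sigma (space M) W"
    using sub_sigma_fieldsD(4) W by blast
  have Y_M: "D \<in> sets M" if "D \<in> Y" for D
    using that sub_sigma_fieldsD(2)[OF Y] by blast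
  have WY: "f \<in> borel_measurable (sigma (space M) Y)"
    if "f \<in> borel_measurable (sigma (space M) W)" for f :: "'a \<Rightarrow> real"
    using measurable_sf_mono[OF W(1) Y W(2) that] .
  have int: "integrable M (\<lambda>x. sf_cond_prob E D x * indicator B x)"
    if "E \<in> sub_sigma_fields M" "D \<in> sets M" "B \<in> sets M" for B D E
    using integrable_mult_indicator[OF that(3) integrable_sf_cond_prob[OF that(1,2)]]
    by (simp add: mult.commute)
  show ?thesis
  proof
    assume m: ?l
    show ?r
    proof
      fix D assume "D \<in> Y"
      \<comment> \<open>Since \<open>sf_cond_prob W D\<close> is \<open>Y\<close>-measurable,
        \<open>A\<close> may be replaced by its conditional probability given \<open>Y\<close>. That
        function is \<open>W\<close>-measurable by assumption, so the conditioning of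
        \<open>D\<close> can then be dropped.\<close>
      have "(\<integral>x. sf_cond_prob W D x * indicator A x \<partial>M)
          = (\<integral>x. sf_cond_prob W D x * sf_cond_prob Y A x \<partial>M)"
        using int[OF W(1) Y_M[OF \<open>D \<in> Y\<close>] A] A
        by (intro Y.real_cond_exp_intg(2)[symmetric]) (auto intro: WY)
      also have "\<dots> = (\<integral>x. sf_cond_prob Y A x * sf_cond_prob W D x \<partial>M)"
        by (simp add: mult.commute)
      also have "\<dots> = (\<integral>x. sf_cond_prob Y A x * indicator D x \<partial>M)"
        using int[OF Y A Y_M[OF \<open>D \<in> Y\<close>]] m Y_M[OF \<open>D \<in> Y\<close>] unfolding cond_prob_measurable_def
        by (intro W.real_cond_exp_intg(2)) auto
      also have "\<dots> = (\<integral>x. indicator D x * sf_cond_prob Y A x \<partial>M)"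
        by (simp add: mult.commute)
      also have "\<dots> = (\<integral>x. indicator D x * indicator A x \<partial>M)"
      proof (rule Y.real_cond_exp_intg(2)[OF _ measurable_indicator_sf[OF Y \<open>D \<in> Y\<close>]])
        show "integrable M (\<lambda>x. indicator D x * indicator A x :: real)"
          using A Y_M[OF \<open>D \<in> Y\<close>] by (simp add: integrable_indicator_prob flip: indicator_inter_arith)
      qed (use A in simp)
      finally show "(\<integral>x. indicator A x * sf_cond_prob W D x \<partial>M)
          = (\<integral>x. indicator A x * indicator D x \<partial>M)"
        by (simp add: mult.commute)
    qed
  next
    assume r: ?r
    \<comment> \<open>After self-adjointness, the assumed identity is the defining property of the
      conditional probability given \<open>Y\<close>.\<close>
    have "AE x in M. sf_cond_prob Y A x = sf_cond_prob W A x"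
    proof (rule sf_cond_prob_AE_eqI[OF Y A integrable_sf_cond_prob[OF W(1) A] WY])
      fix D assume "D \<in> Y"
      then show "(\<integral>x. indicator D x * indicator A x \<partial>M)
          = (\<integral>x. indicator D x * sf_cond_prob W A x \<partial>M)"
        using r sf_cond_prob_self_adjoint[OF W(1) A Y_M] by (simp add: mult.commute)
    qed simp
    then show ?l
      unfolding cond_prob_measurable_def
      by (rule measurable_sf_AE[OF W(1) borel_measurable_cond_exp borel_measurable_cond_exp2])
  qed
qed

text \<open>For each \<open>D\<close> in \<open>Y\<close> the criterion
  \<open>cond_prob_measurable_iff\<close> equates two integrals over \<open>A\<close> with fixed
  integrands, so it extends from \<open>S\<close> to the generated sigma-field. The factor
  \<open>G\<close> is there for joins with an independent sigma-field.\<close>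

lemma cond_prob_measurable_generated:
  assumes Y: "Y \<in> sub_sigma_fields M" and W: "W \<in> sub_sigma_fields M" "W \<subseteq> Y"
    and S: "Int_stable S" "S \<subseteq> sets M" "space M \<in> S" and G: "G \<in> sets M"
    and vis: "\<And>A. A \<in> S \<Longrightarrow> cond_prob_measurable Y W (A \<inter> G)"
    and A: "A \<in> sigma_sets (space M) S"
  shows "cond_prob_measurable Y W (A \<inter> G)"
proof -
  have "A \<in> sets M" using A S(2) sets.sigma_sets_subset by blast
  have "(\<integral>x. indicator A x * (indicator G x * sf_cond_prob W D x) \<partial>M)
      = (\<integral>x. indicator A x * (indicator G x * indicator D x) \<partial>M)" if "D \<in> Y" for D
  proof (rule integral_eq_on_generated[OF S _ _ _ A])
    have D: "D \<in> sets M" using that sub_sigma_fieldsD(2)[OF Y] by blast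
    show "integrable M (\<lambda>x. indicator G x * sf_cond_prob W D x)"
      using integrable_mult_indicator[OF G integrable_sf_cond_prob[OF W(1) D]] by simp
    show "integrable M (\<lambda>x. indicator G x * indicator D x :: real)"
      using G D by (simp add: integrable_indicator_prob flip: indicator_inter_arith)
    fix B assume "B \<in> S"
    then have "B \<inter> G \<in> sets M" using S(2) G by blast
    then show "(\<integral>x. indicator B x * (indicator G x * sf_cond_prob W D x) \<partial>M)
      = (\<integral>x. indicator B x * (indicator G x * indicator D x) \<partial>M)"
      using vis[OF \<open>B \<in> S\<close>] \<open>D \<in> Y\<close> cond_prob_measurable_iff[OF Y W, of "B \<inter> G"]
      by (simp add: indicator_inter_arith mult.assoc)
  qed
  then show ?thesis
    using \<open>A \<in> sets M\<close> G cond_prob_measurable_iff[OF Y W, of "A \<inter> G"]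
    by (simp add: indicator_inter_arith mult.assoc)
qed

lemma cond_prob_measurable_mono:
  assumes "W \<in> sub_sigma_fields M" "W' \<in> sub_sigma_fields M" "W \<subseteq> W'"
    and "cond_prob_measurable Y W A"
  shows "cond_prob_measurable Y W' A"
  using measurable_sf_mono[OF assms(1-3)] assms(4) by (simp add: cond_prob_measurable_def)

text \<open>A single function has its preimages in every \<open>W i\<close>, hence in the
  intersection. This does the work of a convergence theorem for decreasing sigma-fields.\<close>

lemma cond_prob_measurable_Inter:
  assumes I: "I \<noteq> {}" "\<And>i. i \<in> I \<Longrightarrow> W i \<in> sub_sigma_fields M"
    and m: "\<And>i. i \<in> I \<Longrightarrow> cond_prob_measurable Y (W i) A"
  shows "cond_prob_measurable Y (\<Inter>i\<in>I. W i) A"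
  unfolding cond_prob_measurable_def
proof (rule measurableI)
  fix S :: "real set" assume S: "S \<in> sets borel"
  have "sf_cond_prob Y A -` S \<inter> space M \<in> W i" if "i \<in> I" for i
    using measurable_sets[OF m[OF that, unfolded cond_prob_measurable_def] S]
      sub_sigma_fieldsD(5,6)[OF I(2)[OF that]] by simp
  then have "sf_cond_prob Y A -` S \<inter> space M \<in> (\<Inter>i\<in>I. W i)" by (rule INT_I)
  moreover have "(\<Inter>i\<in>I. W i) \<in> sub_sigma_fields M" by (rule sub_sigma_fields_Inter[OF I])
  ultimately show "sf_cond_prob Y A -` S \<inter> space (sigma (space M) (\<Inter>i\<in>I. W i))
      \<in> sets (sigma (space M) (\<Inter>i\<in>I. W i))"
    by (simp only: sub_sigma_fieldsD(5,6))
qed simp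

text \<open>Conditional probabilities given \<open>Y\<close> are \<open>Y\<close>-measurable anyway.
  The lemma secures the inclusion in \<open>Y\<close> that \<open>cond_prob_measurable_iff\<close>
  demands.\<close>

lemma cond_prob_measurable_Int:
  assumes "W \<in> sub_sigma_fields M" "Y \<in> sub_sigma_fields M" "cond_prob_measurable Y W A"
  shows "cond_prob_measurable Y (W \<inter> Y) A"
proof -
  have "cond_prob_measurable Y (\<Inter>i\<in>{W, Y}. i) A"
  proof (rule cond_prob_measurable_Inter)
    have "cond_prob_measurable Y Y A" by (simp add: cond_prob_measurable_def)
    then show "i \<in> sub_sigma_fields M" "cond_prob_measurable Y i A" if "i \<in> {W, Y}" for i
      using that assms by blast+
  qed simp
  then show ?thesis by simp
qed

text \<open>For \<open>A\<close> in \<open>Y\<close> the conditional probability given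
  \<open>Y\<close> is almost everywhere the indicator of \<open>A\<close>. This turns measurability
  back into membership.\<close>

lemma mem_if_cond_prob_measurable:
  assumes Y: "Y \<in> sub_sigma_fields M" and W: "W \<in> sub_sigma_fields M"
    and A: "A \<in> Y" "cond_prob_measurable Y W A"
  shows "A \<in> W"
proof (rule indicator_measurable_sf[OF W])
  show AM: "A \<in> sets M" using A sub_sigma_fieldsD(2)[OF Y] by blast
  interpret sigma_finite_subalgebra M "sigma (space M) Y"
    using sub_sigma_fieldsD(4) Y by blast
  have "AE x in M. sf_cond_prob Y A x = indicator A x"
    using AM A measurable_indicator_sf[OF Y] integrable_indicator_prob
    by (intro real_cond_exp_F_meas) auto
  then have "AE x in M. indicator A x = sf_cond_prob Y A x"
    by (auto elim: eventually_mono)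
  then show "(indicator A :: 'a \<Rightarrow> real) \<in> borel_measurable (sigma (space M) W)"
    by (rule measurable_sf_AE[OF W A(2)[unfolded cond_prob_measurable_def] borel_measurable_indicator[OF AM]])
qed

section \<open>Commuting sigma-fields\<close>

lemma sf_commuteD:
  assumes "X \<in> sub_sigma_fields M" "Y \<in> sub_sigma_fields M" "sf_commute X Y" "A \<in> X"
  shows "cond_prob_measurable Y (X \<inter> Y) A"
  using assms by (intro cond_prob_measurable_Int) (auto simp: sf_commute_def)

text \<open>Relative to \<open>X \<inter> Y\<close>, the criterion for \<open>A\<close> in
  \<open>X\<close> tested on \<open>D\<close> in \<open>Y\<close> and the one for \<open>D\<close>
  tested on \<open>A\<close> are the same identity, by self-adjointness.\<close>

lemma sf_commute_sym:
  assumes X: "X \<in> sub_sigma_fields M" and Y: "Y \<in> sub_sigma_fields M" and c: "sf_commute X Y"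
  shows "sf_commute Y X"
  unfolding sf_commute_def
proof
  fix D assume D: "D \<in> Y"
  have W: "X \<inter> Y \<in> sub_sigma_fields M" using sub_sigma_fields_Int[OF X Y] .
  have DM: "D \<in> sets M" using D sub_sigma_fieldsD(2)[OF Y] by blast
  have "cond_prob_measurable X (X \<inter> Y) D"
    unfolding cond_prob_measurable_iff[OF X W Int_lower1 DM]
  proof
    fix A assume A: "A \<in> X"
    have AM: "A \<in> sets M" using A sub_sigma_fieldsD(2)[OF X] by blast
    have "(\<integral>x. indicator A x * sf_cond_prob (X \<inter> Y) D x \<partial>M) = (\<integral>x. indicator A x * indicator D x \<partial>M)"
      using sf_commuteD[OF X Y c A] D unfolding cond_prob_measurable_iff[OF Y W Int_lower2 AM]
      by blast
    then show "(\<integral>x. indicator D x * sf_cond_prob (X \<inter> Y) A x \<partial>M) = (\<integral>x. indicator D x * indicator A x \<partial>M)"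
      using sf_cond_prob_self_adjoint[OF W AM DM] by (simp add: mult.commute)
  qed
  then show "cond_prob_measurable X Y D"
    by (rule cond_prob_measurable_mono[OF W Y Int_lower2])
qed

lemma sf_commute_Inter:
  assumes "I \<noteq> {}" "\<And>i. i \<in> I \<Longrightarrow> E i \<in> sub_sigma_fields M" "\<And>i. i \<in> I \<Longrightarrow> sf_commute (E i) Y"
  shows "sf_commute (\<Inter>i\<in>I. E i) Y"
  using assms unfolding sf_commute_def by (auto intro!: cond_prob_measurable_Inter)

section \<open>Increasing limits\<close>

lemma sub_sigma_fields_SUP:
  assumes "\<And>n :: nat. E n \<in> sub_sigma_fields M"
  shows "sigma_sets (space M) (\<Union>n. E n) \<in> sub_sigma_fields M"
proof (rule sub_sigma_fields_sigma_sets)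
  show "(\<Union>n. E n) \<subseteq> sets M" using sub_sigma_fieldsD(2)[OF assms] by (rule UN_least)
  show "null_sets M \<subseteq> (\<Union>n. E n)" using sub_sigma_fieldsD(3)[OF assms[of 0]] by blast
qed

text \<open>The union of an increasing sequence of sigma-fields is stable under intersection, so the
  pi-lambda extension applies, with the whole space as \<open>G\<close>.\<close>

lemma cond_prob_measurable_incseq:
  assumes E: "incseq E" "\<And>n. E n \<in> sub_sigma_fields M"
    and Y: "Y \<in> sub_sigma_fields M" and W: "W \<in> sub_sigma_fields M"
    and m: "\<And>n A. A \<in> E n \<Longrightarrow> cond_prob_measurable Y W A"
    and A: "A \<in> sigma_sets (space M) (\<Union>n. E n)"
  shows "cond_prob_measurable Y W A"
proof -
  have WY: "W \<inter> Y \<in> sub_sigma_fields M" using sub_sigma_fields_Int[OF W Y] .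
  have EM: "A \<in> sets M" if "A \<in> E n" for A n using that sub_sigma_fieldsD(2)[OF E(2)] by blast
  have "cond_prob_measurable Y (W \<inter> Y) (A \<inter> space M)"
  proof (rule cond_prob_measurable_generated[OF Y WY Int_lower2 _ _ _ _ _ A])
    show "Int_stable (\<Union>n. E n)"
    proof (rule Int_stableI)
      fix A B assume "A \<in> (\<Union>n. E n)" "B \<in> (\<Union>n. E n)"
      then obtain m n where mn: "A \<in> E m" "B \<in> E n" by blast
      have "A \<in> E (max m n)" "B \<in> E (max m n)"
        using mn monoD[OF E(1), of m "max m n"] monoD[OF E(1), of n "max m n"] by auto
      then have "A \<inter> B \<in> E (max m n)"
        using sub_sigma_fieldsD(1)[OF E(2), of "max m n"]
        by (auto simp: sigma_algebra_def algebra_iff_Int)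
      then show "A \<inter> B \<in> (\<Union>n. E n)" by blast
    qed
    show "space M \<in> (\<Union>n. E n)" using sub_sigma_fieldsD(7)[OF E(2)] by blast
    fix B assume B: "B \<in> (\<Union>n. E n)"
    then have "B \<inter> space M = B" using EM sets.sets_into_space by blast
    then show "cond_prob_measurable Y (W \<inter> Y) (B \<inter> space M)"
      using B m cond_prob_measurable_Int[OF W Y] by auto
  qed (use EM in auto)
  moreover have "A \<inter> space M = A"
    using A sub_sigma_fieldsD(2)[OF sub_sigma_fields_SUP[of E]] E(2) sets.sets_into_space by blast
  ultimately show ?thesis
    using cond_prob_measurable_mono[OF WY W] by simp
qed

lemma sf_commute_incseq:
  assumes E: "incseq E" "\<And>n. E n \<in> sub_sigma_fields M"
    and Y: "Y \<in> sub_sigma_fields M" and c: "\<And>n. sf_commute (E n) Y"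
  shows "sf_commute (sigma_sets (space M) (\<Union>n. E n)) Y"
  unfolding sf_commute_def
proof
  have J: "sigma_sets (space M) (\<Union>n. E n) \<in> sub_sigma_fields M"
    by (rule sub_sigma_fields_SUP[OF E(2)])
  have sub: "E n \<subseteq> sigma_sets (space M) (\<Union>n. E n)" for n by auto
  have "cond_prob_measurable Y (sigma_sets (space M) (\<Union>n. E n)) A" if "A \<in> E n" for A n
    by (rule cond_prob_measurable_mono[OF E(2) J sub, of _ n])
      (use c[of n] that in \<open>simp add: sf_commute_def\<close>)
  then show "cond_prob_measurable Y (sigma_sets (space M) (\<Union>n. E n)) A"
    if "A \<in> sigma_sets (space M) (\<Union>n. E n)" for A
    using that by (rule cond_prob_measurable_incseq[OF E Y J])
qed

text \<open>The inclusion from right to left is monotonicity. For the other one, commutation makes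
  \<open>sf_cond_prob Y A\<close> measurable for the right-hand side when \<open>A\<close> lies in
  some \<open>E n\<close>, hence for all \<open>A\<close> in the limit; if also \<open>A\<close> is
  in \<open>Y\<close>, this puts \<open>A\<close> itself there.\<close>

lemma incseq_Int:
  assumes E: "incseq E" "\<And>n. E n \<in> sub_sigma_fields M"
    and Y: "Y \<in> sub_sigma_fields M" and c: "\<And>n. sf_commute (E n) Y"
  shows "sigma_sets (space M) (\<Union>n. E n) \<inter> Y = sigma_sets (space M) (\<Union>n. E n \<inter> Y)"
proof (intro antisym subsetI)
  have J: "sigma_sets (space M) (\<Union>n. E n \<inter> Y) \<in> sub_sigma_fields M"
    by (rule sub_sigma_fields_SUP[OF sub_sigma_fields_Int[OF E(2) Y]])
  have sub: "E n \<inter> Y \<subseteq> sigma_sets (space M) (\<Union>n. E n \<inter> Y)" for n by auto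
  fix A assume A: "A \<in> sigma_sets (space M) (\<Union>n. E n) \<inter> Y"
  have "cond_prob_measurable Y (sigma_sets (space M) (\<Union>n. E n \<inter> Y)) B" if "B \<in> E n" for B n
    by (rule cond_prob_measurable_mono[OF sub_sigma_fields_Int[OF E(2) Y] J sub
          sf_commuteD[OF E(2) Y c that]])
  then have "cond_prob_measurable Y (sigma_sets (space M) (\<Union>n. E n \<inter> Y)) A"
    using A by (intro cond_prob_measurable_incseq[OF E Y J, of A]) blast+
  then show "A \<in> sigma_sets (space M) (\<Union>n. E n \<inter> Y)"
    using A mem_if_cond_prob_measurable[OF Y J] by blast
next
  fix A assume A: "A \<in> sigma_sets (space M) (\<Union>n. E n \<inter> Y)"
  have "sigma_sets (space M) (\<Union>n. E n \<inter> Y) \<subseteq> Y"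
    by (intro sigma_algebra.sigma_sets_subset[OF sub_sigma_fieldsD(1)[OF Y]]) blast
  moreover have "sigma_sets (space M) (\<Union>n. E n \<inter> Y) \<subseteq> sigma_sets (space M) (\<Union>n. E n)"
    by (intro sigma_sets_subseteq) blast
  ultimately show "A \<in> sigma_sets (space M) (\<Union>n. E n) \<inter> Y" using A by blast
qed

subsection \<open>Joins of independent \<open>\<sigma>\<close>-fields\<close>

lemma indep_set_mono:
  "indep_set X Y \<Longrightarrow> X' \<subseteq> X \<Longrightarrow> Y' \<subseteq> Y \<Longrightarrow> indep_set X' Y'"
  unfolding indep_sets2_eq by blast

lemma indep_set_sym: "indep_set X Y \<Longrightarrow> indep_set Y X"
  unfolding indep_sets2_eq by (metis Int_commute mult.commute)

text \<open>
  Heuristically the space is a product \<open>X \<times> V\<close>, and conditioning \<open>A \<inter> G\<close> on \<open>X\<close> integrates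
  the second coordinate over \<open>G\<close>. This lemma and the next one say that \<open>A\<close> belongs to the join
  of \<open>U \<subseteq> X\<close> and \<open>V\<close> iff all these partial integrals are \<open>U\<close>-measurable.
\<close>

lemma cond_prob_measurable_join:
  assumes X: "X \<in> sub_sigma_fields M" and V: "V \<in> sub_sigma_fields M"
    and U: "U \<in> sub_sigma_fields M" "U \<subseteq> X" and ind: "indep_set X V"
    and A: "A \<in> sf_join M U V" and G: "G \<in> V"
  shows "cond_prob_measurable X U (A \<inter> G)"
proof (rule cond_prob_measurable_generated[OF X U Int_stable_Int[OF U(1) V]])
  interpret V: sigma_algebra "space M" V by (rule sub_sigma_fieldsD(1)[OF V])
  interpret X: sigma_algebra "space M" X by (rule sub_sigma_fieldsD(1)[OF X])
  have M: "X \<subseteq> sets M" "V \<subseteq> sets M" "U \<subseteq> sets M"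
    using X V U sub_sigma_fieldsD(2) by blast+
  show "{A \<inter> B |A B. A \<in> U \<and> B \<in> V} \<subseteq> sets M" using M by blast
  show "space M \<in> {A \<inter> B |A B. A \<in> U \<and> B \<in> V}"
    using sub_sigma_fieldsD(7)[OF U(1)] sub_sigma_fieldsD(7)[OF V] by blast
  show "G \<in> sets M" using G M by blast
  show "A \<in> sigma_sets (space M) {A \<inter> B |A B. A \<in> U \<and> B \<in> V}"
    using A sigma_sets_eq_sf_join[OF U(1) V] by simp
  fix B assume "B \<in> {A \<inter> B |A B. A \<in> U \<and> B \<in> V}"
  then obtain F H where B: "B = F \<inter> H" "F \<in> U" "H \<in> V" by blast
  have FHG: "F \<in> sets M" "H \<inter> G \<in> V" "H \<inter> G \<in> sets M" "B \<inter> G = F \<inter> (H \<inter> G)"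
    using B G M by auto
  \<comment> \<open>By independence this is a version of the conditional probability of
    \<open>F \<inter> (H \<inter> G)\<close> given \<open>X\<close>; it is
    \<open>U\<close>-measurable because \<open>F\<close> lies in \<open>U\<close>.\<close>
  let ?h = "\<lambda>x. indicator F x * prob (H \<inter> G)"
  have meas: "?h \<in> borel_measurable (sigma (space M) U)"
    using measurable_indicator_sf[OF U(1) B(2)] by simp
  have "AE x in M. sf_cond_prob X (B \<inter> G) x = ?h x"
  proof (rule sf_cond_prob_AE_eqI[OF X])
    show "B \<inter> G \<in> sets M" using FHG by auto
    show "integrable M ?h" using integrable_indicator_prob[OF FHG(1)] by simp
    show "?h \<in> borel_measurable (sigma (space M) X)"
      by (rule measurable_sf_mono[OF U(1) X U(2) meas])
    fix D assume D: "D \<in> X"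
    have DF: "D \<inter> F \<in> X" "D \<inter> F \<in> sets M" using D B U(2) M by auto
    have "(\<integral>x. indicator D x * (indicator (B \<inter> G) x :: real) \<partial>M)
        = (\<integral>x. (indicator ((D \<inter> F) \<inter> (H \<inter> G)) x :: real) \<partial>M)"
      unfolding FHG(4) by (intro Bochner_Integration.integral_cong) (auto simp: indicator_def)
    also have "\<dots> = prob ((D \<inter> F) \<inter> (H \<inter> G))"
      using DF FHG by simp
    also have "\<dots> = prob (D \<inter> F) * prob (H \<inter> G)"
      by (rule indep_setD[OF ind DF(1) FHG(2)])
    also have "\<dots> = (\<integral>x. indicator (D \<inter> F) x * prob (H \<inter> G) \<partial>M)"
      using DF by simp
    also have "\<dots> = (\<integral>x. indicator D x * ?h x \<partial>M)"
      by (simp add: indicator_inter_arith mult.assoc)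
    finally show "(\<integral>x. indicator D x * indicator (B \<inter> G) x \<partial>M) = (\<integral>x. indicator D x * ?h x \<partial>M)" .
  qed
  then show "cond_prob_measurable X U (B \<inter> G)"
    unfolding cond_prob_measurable_def
    by (rule measurable_sf_AE[OF U(1) meas borel_measurable_cond_exp2])
qed

lemma mem_sf_joinI:
  assumes X: "X \<in> sub_sigma_fields M" and V: "V \<in> sub_sigma_fields M"
    and U: "U \<in> sub_sigma_fields M" "U \<subseteq> X" and ind: "indep_set X V"
    and A: "A \<in> sf_join M X V" and m: "\<And>G. G \<in> V \<Longrightarrow> cond_prob_measurable X U (A \<inter> G)"
  shows "A \<in> sf_join M U V"
proof -
  let ?J = "sf_join M U V"
  have XV: "sf_join M X V \<in> sub_sigma_fields M" and J: "?J \<in> sub_sigma_fields M"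
    using sf_join_sub_sigma_fields X V U(1) by blast+
  have JXV: "?J \<subseteq> sf_join M X V" using sf_join_mono[OF U(2)] by blast
  have M: "D \<in> sets M" if "D \<in> X \<or> D \<in> V \<or> D \<in> U \<or> D \<in> ?J \<or> D \<in> sf_join M X V" for D
    using that X V U XV J sub_sigma_fieldsD(2) by blast
  have AM: "A \<in> sets M" using A M by blast
  \<comment> \<open>The sets \<open>F \<inter> G\<close> generate \<open>sf_join M X V\<close>.
    Extended to that join, the identity says that conditioning on \<open>?J\<close> leaves the
    indicator of \<open>A\<close> unchanged.\<close>
  have rect: "(\<integral>x. indicator (F \<inter> G) x * sf_cond_prob ?J A x \<partial>M)
      = (\<integral>x. indicator (F \<inter> G) x * indicator A x \<partial>M)" if F: "F \<in> X" and G: "G \<in> V" for F G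
  proof -
    have FG: "F \<in> sets M" "G \<in> sets M" "F \<inter> G \<in> sets M" using F G M by auto
    \<comment> \<open>This is a version of the conditional probability of
      \<open>F \<inter> G\<close> given \<open>?J\<close>: the factor for \<open>G\<close> is
      \<open>?J\<close>-measurable, and the independent \<open>V\<close> adds nothing to what
      \<open>U\<close> knows about \<open>F\<close>.\<close>
    let ?h = "\<lambda>x. indicator G x * sf_cond_prob U F x"
    have hJ: "?h \<in> borel_measurable (sigma (space M) ?J)"
    proof (rule borel_measurable_times)
      show "(indicator G :: 'a \<Rightarrow> real) \<in> borel_measurable (sigma (space M) ?J)"
        using measurable_indicator_sf[OF J] G sf_join_upper(2)[of V U] by blast
      show "sf_cond_prob U F \<in> borel_measurable (sigma (space M) ?J)"
        by (rule measurable_sf_mono[OF U(1) J sf_join_upper(1)]) simp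
    qed
    have "AE x in M. sf_cond_prob ?J (F \<inter> G) x = ?h x"
    proof (rule sf_cond_prob_AE_eqI[OF J FG(3) _ hJ])
      show "integrable M ?h"
        using integrable_mult_indicator[OF FG(2) integrable_sf_cond_prob[OF U(1) FG(1)]] by simp
      fix D assume D: "D \<in> ?J"
      have DG: "D \<inter> G \<in> sets M" using D M FG by blast
      have "(\<integral>x. indicator (D \<inter> G) x * sf_cond_prob U F x \<partial>M)
          = (\<integral>x. indicator (D \<inter> G) x * indicator F x \<partial>M)"
        using cond_prob_measurable_join[OF X V U ind D G] F
        unfolding cond_prob_measurable_iff[OF X U DG] by blast
      then show "(\<integral>x. indicator D x * indicator (F \<inter> G) x \<partial>M) = (\<integral>x. indicator D x * ?h x \<partial>M)"
        by (simp add: indicator_inter_arith mult_ac)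
    qed
    then have "(\<integral>x. indicator A x * sf_cond_prob ?J (F \<inter> G) x \<partial>M) = (\<integral>x. indicator A x * ?h x \<partial>M)"
      using AM FG measurable_sf_M[OF J hJ] by (intro integral_cong_AE) auto
    also have "\<dots> = (\<integral>x. indicator (A \<inter> G) x * sf_cond_prob U F x \<partial>M)"
      by (simp add: indicator_inter_arith mult_ac)
    \<comment> \<open>The assumption \<open>m\<close> on the partial integrals of \<open>A\<close>
      enters here.\<close>
    also have "\<dots> = (\<integral>x. indicator (A \<inter> G) x * indicator F x \<partial>M)"
    proof -
      have "A \<inter> G \<in> sets M" using AM FG by blast
      then show ?thesis
        using m[OF G] F cond_prob_measurable_iff[OF X U, of "A \<inter> G"] by blast
    qed
    also have "\<dots> = (\<integral>x. indicator (F \<inter> G) x * indicator A x \<partial>M)"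
      by (simp add: indicator_inter_arith mult_ac)
    finally show ?thesis
      using sf_cond_prob_self_adjoint[OF J AM FG(3)] by simp
  qed
  have "cond_prob_measurable (sf_join M X V) ?J A"
    unfolding cond_prob_measurable_iff[OF XV J JXV AM]
  proof
    fix D assume D: "D \<in> sf_join M X V"
    have DM: "D \<in> sets M" using D M by blast
    have "(\<integral>x. indicator D x * sf_cond_prob ?J A x \<partial>M) = (\<integral>x. indicator D x * indicator A x \<partial>M)"
      by (rule sf_join_integral_eq[OF X V integrable_sf_cond_prob[OF J AM]
            integrable_indicator_prob[OF AM] rect D])
    then show "(\<integral>x. indicator A x * sf_cond_prob ?J D x \<partial>M) = (\<integral>x. indicator A x * indicator D x \<partial>M)"
      using sf_cond_prob_self_adjoint[OF J AM DM] by (simp add: mult.commute)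
  qed
  then show ?thesis
    by (rule mem_if_cond_prob_measurable[OF XV J A])
qed

text \<open>The partial integrals of \<open>A\<close> over sets of \<open>V\<close> are measurable
  for each \<open>U i\<close>, hence for their intersection. A common \<open>X\<close> independent
  of \<open>V\<close> makes them the same functions for all \<open>i\<close>.\<close>

lemma INT_sf_join_subset:
  assumes X: "X \<in> sub_sigma_fields M" and V: "V \<in> sub_sigma_fields M" and ind: "indep_set X V"
    and U: "I \<noteq> {}" "\<And>i. i \<in> I \<Longrightarrow> U i \<in> sub_sigma_fields M" "\<And>i. i \<in> I \<Longrightarrow> U i \<subseteq> X"
  shows "(\<Inter>i\<in>I. sf_join M (U i) V) \<subseteq> sf_join M (\<Inter>i\<in>I. U i) V"
proof
  fix A assume A: "A \<in> (\<Inter>i\<in>I. sf_join M (U i) V)"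
  show "A \<in> sf_join M (\<Inter>i\<in>I. U i) V"
  proof (rule mem_sf_joinI[OF X V _ _ ind])
    show "(\<Inter>i\<in>I. U i) \<in> sub_sigma_fields M" by (rule sub_sigma_fields_Inter[OF U(1,2)])
    obtain i where i: "i \<in> I" using U(1) by blast
    show "(\<Inter>i\<in>I. U i) \<subseteq> X" using U(3)[OF i] i by (rule INF_lower2[rotated])
    show "A \<in> sf_join M X V" by (rule subsetD[OF sf_join_mono[OF U(3)[OF i] order_refl] INT_D[OF A i]])
    show "cond_prob_measurable X (\<Inter>i\<in>I. U i) (A \<inter> G)" if "G \<in> V" for G
    proof (rule cond_prob_measurable_Inter[OF U(1,2)])
      fix i assume i: "i \<in> I"
      then have "A \<in> sf_join M (U i) V" using A by blast
      then show "cond_prob_measurable X (U i) (A \<inter> G)"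
        by (rule cond_prob_measurable_join[OF X V U(2)[OF i] U(3)[OF i] ind _ that])
    qed
  qed
qed

text \<open>Taking the whole space as \<open>G\<close>, conditioning a set of the join on
  \<open>X\<close> gives a \<open>U\<close>-measurable function; for a set of \<open>X\<close> this
  function is its indicator.\<close>

lemma Int_sf_join_subset:
  assumes X: "X \<in> sub_sigma_fields M" and V: "V \<in> sub_sigma_fields M" and ind: "indep_set X V"
    and U: "U \<in> sub_sigma_fields M" "U \<subseteq> X"
  shows "X \<inter> sf_join M U V \<subseteq> U"
proof
  fix A assume A: "A \<in> X \<inter> sf_join M U V"
  then have "A \<inter> space M = A" using sub_sigma_fieldsD(2)[OF X] sets.sets_into_space by blast
  then have "cond_prob_measurable X U A"
    using cond_prob_measurable_join[OF X V U ind _ sub_sigma_fieldsD(7)[OF V], of A] A by simp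
  then show "A \<in> U" using mem_if_cond_prob_measurable[OF X U(1)] A by blast
qed

section \<open>Independence from commutation and trivial intersection\<close>

lemma trivial_sf_subset: "E \<in> sub_sigma_fields M \<Longrightarrow> trivial_sf M \<subseteq> E"
proof
  fix A assume E: "E \<in> sub_sigma_fields M" and A: "A \<in> trivial_sf M"
  interpret sigma_algebra "space M" E by (rule sub_sigma_fieldsD(1)[OF E])
  have "A \<in> E \<or> space M - A \<in> E"
    using A sub_sigma_fieldsD(3)[OF E] unfolding trivial_sf_def by blast
  moreover have "space M - (space M - A) = A"
    using A sets.sets_into_space unfolding trivial_sf_def by blast
  ultimately show "A \<in> E" using compl_sets[of "space M - A"] by auto
qed

text \<open>The conditional probability of \<open>D\<close> given the trivial sigma-field is the
  constant \<open>prob D\<close>. Put into the criterion for commuting sigma-fields, it yields the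
  product formula.\<close>

lemma sf_commute_indep_set:
  assumes X: "X \<in> sub_sigma_fields M" and Y: "Y \<in> sub_sigma_fields M"
    and c: "sf_commute X Y" and triv: "X \<inter> Y = trivial_sf M"
  shows "indep_set X Y"
proof (rule indep_setI)
  show M: "X \<subseteq> sets M" "Y \<subseteq> sets M" using X Y sub_sigma_fieldsD(2) by blast+
  have T: "trivial_sf M \<in> sub_sigma_fields M" using sub_sigma_fields_Int[OF X Y] triv by simp
  fix A D assume A: "A \<in> X" and D: "D \<in> Y"
  have AD: "A \<in> sets M" "D \<in> sets M" using A D M by blast+
  have AE1: "AE x in M. sf_cond_prob (trivial_sf M) D x = prob D"
  proof (rule sf_cond_prob_AE_eqI[OF T AD(2)])
    fix N assume N: "N \<in> trivial_sf M"
    then have NM: "N \<in> sets M" by (simp add: trivial_sf_def)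
    have "prob (N \<inter> D) = prob N * prob D"
    proof (cases "N \<in> null_sets M")
      case True
      then have "N \<inter> D \<in> null_sets M" using AD(2) by (rule null_set_Int2)
      with True show ?thesis by (simp add: measure_eq_0_null_sets)
    next
      case False
      then have n: "space M - N \<in> null_sets M" using N by (simp add: trivial_sf_def)
      have "prob N = 1"
        using prob_compl[OF NM] measure_eq_0_null_sets[OF n] by simp
      moreover have "prob (N \<inter> D) = prob D"
        by (rule measure_eq_AE) (use AE_not_in[OF n] NM AD in \<open>auto elim!: eventually_mono\<close>)
      ultimately show ?thesis by simp
    qed
    then show "(\<integral>x. indicator N x * indicator D x \<partial>M) = (\<integral>x. indicator N x * prob D \<partial>M)"
      using NM AD by (simp flip: indicator_inter_arith)
  qed simp_all
  have "cond_prob_measurable Y (X \<inter> Y) A" using sf_commuteD[OF X Y c A] .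
  then have "(\<integral>x. indicator A x * sf_cond_prob (trivial_sf M) D x \<partial>M) = (\<integral>x. indicator A x * indicator D x \<partial>M)"
    using D triv cond_prob_measurable_iff[OF Y sub_sigma_fields_Int[OF X Y] Int_lower2 AD(1)] by simp
  moreover have "(\<integral>x. indicator A x * sf_cond_prob (trivial_sf M) D x \<partial>M) = (\<integral>x. indicator A x * prob D \<partial>M)"
    using AE1 AD by (intro integral_cong_AE) auto
  ultimately show "prob (A \<inter> D) = prob A * prob D"
    using AD by (simp flip: indicator_inter_arith)
qed

end

subsection \<open>Complemented elements of the monotone closure\<close>

text \<open>The inductive form, rather than an intersection of monotonically closed sets, provides
  induction from \<open>B\<close> through limits of both kinds.\<close>

inductive_set monotone_closure :: "'a measure \<Rightarrow> 'a set set set \<Rightarrow> 'a set set set"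
  for M :: "'a measure" and B :: "'a set set set" where
  base: "E \<in> B \<Longrightarrow> E \<in> monotone_closure M B"
| dec: "(\<And>n. E n \<in> monotone_closure M B) \<Longrightarrow> decseq E \<Longrightarrow> (\<Inter>n :: nat. E n) \<in> monotone_closure M B"
| inc: "(\<And>n. E n \<in> monotone_closure M B) \<Longrightarrow> incseq E \<Longrightarrow>
    sigma_sets (space M) (\<Union>n :: nat. E n) \<in> monotone_closure M B"

lemma monotone_closure_subset:
  assumes Z: "monotonically_closed M Z" "B \<subseteq> Z"
  shows "monotone_closure M B \<subseteq> Z"
proof
  fix E assume "E \<in> monotone_closure M B"
  then show "E \<in> Z"
  proof induction
    case (base E)
    then show ?case using Z(2) by blast
  next
    case (dec E)
    then have "range E \<subseteq> Z" by blast
    then show ?case using Z(1) dec(2) unfolding monotonically_closed_def by blast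
  next
    case (inc E)
    then have "range E \<subseteq> Z" by blast
    then show ?case using Z(1) inc(2) unfolding monotonically_closed_def by blast
  qed
qed

lemma noise_type_boolean_algebraD:
  assumes "noise_type_boolean_algebra M B"
  shows "B \<subseteq> sub_sigma_fields M"
    "trivial_sf M \<in> B"
    "sets M \<in> B"
    "\<forall>E\<in>B. \<forall>F\<in>B. E \<inter> F \<in> B"
    "\<forall>E\<in>B. \<forall>F\<in>B. sf_join M E F \<in> B"
    "\<forall>E\<in>B. \<forall>F\<in>B. \<forall>G\<in>B. E \<inter> sf_join M F G = sf_join M (E \<inter> F) (E \<inter> G)"
    "\<forall>E\<in>B. \<exists>F\<in>B. E \<inter> F = trivial_sf M \<and> sf_join M E F = sets M"
    "\<forall>E\<in>B. \<forall>F\<in>B. E \<inter> F = trivial_sf M \<longrightarrow> prob_space.indep_set M E F"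
proof -
  note D = assms[unfolded noise_type_boolean_algebra_def]
  show "B \<subseteq> sub_sigma_fields M"
    using D by (elim conjE)
  show "trivial_sf M \<in> B"
    using D by (elim conjE)
  show "sets M \<in> B"
    using D by (elim conjE)
  show "\<forall>E\<in>B. \<forall>F\<in>B. E \<inter> F \<in> B"
    using D by (elim conjE)
  show "\<forall>E\<in>B. \<forall>F\<in>B. sf_join M E F \<in> B"
    using D by (elim conjE)
  show "\<forall>E\<in>B. \<forall>F\<in>B. \<forall>G\<in>B. E \<inter> sf_join M F G = sf_join M (E \<inter> F) (E \<inter> G)"
    using D by (elim conjE)
  show "\<forall>E\<in>B. \<exists>F\<in>B. E \<inter> F = trivial_sf M \<and> sf_join M E F = sets M"
    using D by (elim conjE)
  show "\<forall>E\<in>B. \<forall>F\<in>B. E \<inter> F = trivial_sf M \<longrightarrow> prob_space.indep_set M E F"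
    using D by (elim conjE)
qed

section \<open>The monotone closure of a noise-type Boolean algebra\<close>

locale noise_boolean_algebra = prob_space M for M :: "'a measure" +
  fixes B :: "'a set set set"
  assumes noise: "noise_type_boolean_algebra M B"
begin

abbreviation "Z \<equiv> monotone_closure M B"

lemma B_sub_sigma_fields: "x \<in> B \<Longrightarrow> x \<in> sub_sigma_fields M"
  using noise_type_boolean_algebraD(1)[OF noise] by blast

lemma Z_sub_sigma_fields: "x \<in> Z \<Longrightarrow> x \<in> sub_sigma_fields M"
proof (induction rule: monotone_closure.induct)
  case (dec E)
  then show ?case by (intro sub_sigma_fields_Inter) auto
next
  case (inc E)
  then show ?case by (intro sub_sigma_fields_SUP) auto
qed (rule B_sub_sigma_fields)

lemma monotonically_closed_Z: "monotonically_closed M Z"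
  unfolding monotonically_closed_def
proof (intro conjI allI impI)
  show "Z \<subseteq> sub_sigma_fields M" using Z_sub_sigma_fields by blast
  show "(\<Inter>n. E n) \<in> Z" if "range E \<subseteq> Z \<and> decseq E" for E :: "nat \<Rightarrow> 'a set set"
    using that by (intro monotone_closure.dec) auto
  show "sigma_sets (space M) (\<Union>n. E n) \<in> Z" if "range E \<subseteq> Z \<and> incseq E" for E :: "nat \<Rightarrow> 'a set set"
    using that by (intro monotone_closure.inc) auto
qed

text \<open>\<open>Z\<close> is itself monotonically closed, and it is the least such set containing
  \<open>B\<close>.\<close>

lemma monotonically_dense_iff: "monotonically_dense M B D \<longleftrightarrow> D \<subseteq> Z"
proof
  assume "monotonically_dense M B D"
  then show "D \<subseteq> Z"
    using monotonically_closed_Z monotone_closure.base unfolding monotonically_dense_def by blast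
next
  assume "D \<subseteq> Z"
  then show "monotonically_dense M B D"
    unfolding monotonically_dense_def using monotone_closure_subset by blast
qed

lemma B_Int: "x \<in> B \<Longrightarrow> y \<in> B \<Longrightarrow> x \<inter> y \<in> B"
  using noise_type_boolean_algebraD(4)[OF noise] by blast

lemma B_join: "x \<in> B \<Longrightarrow> y \<in> B \<Longrightarrow> sf_join M x y \<in> B"
  using noise_type_boolean_algebraD(5)[OF noise] by blast

lemma B_indep: "x \<in> B \<Longrightarrow> y \<in> B \<Longrightarrow> x \<inter> y = trivial_sf M \<Longrightarrow> indep_set x y"
  using noise_type_boolean_algebraD(8)[OF noise] by blast

lemma B_complement:
  assumes "x \<in> B"
  obtains y where "y \<in> B" "x \<inter> y = trivial_sf M" "sf_join M x y = sets M"
  using noise_type_boolean_algebraD(7)[OF noise] assms by blast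

lemma B_split:
  assumes "x \<in> B" "y \<in> B" "sf_join M x y = sets M" "b \<in> B"
  shows "b \<subseteq> sf_join M (b \<inter> x) (b \<inter> y)"
proof -
  have "b \<inter> sf_join M x y = sf_join M (b \<inter> x) (b \<inter> y)"
    by (rule noise_type_boolean_algebraD(6)[OF noise, rule_format, OF assms(4,1,2)])
  then show ?thesis
    using assms(3) sub_sigma_fieldsD(2)[OF B_sub_sigma_fields[OF assms(4)]] by blast
qed

text \<open>With a complement \<open>y'\<close> of \<open>y\<close>, distributivity places
  \<open>A\<close> in the join of \<open>x \<inter> y\<close> and \<open>y'\<close>. As
  \<open>y'\<close> is independent of \<open>y\<close>, conditioning on \<open>y\<close> leaves an
  \<open>x \<inter> y\<close>-measurable function.\<close>

lemma B_commute:
  assumes x: "x \<in> B" and y: "y \<in> B"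
  shows "sf_commute x y"
  unfolding sf_commute_def
proof
  fix A assume A: "A \<in> x"
  obtain y' where y': "y' \<in> B" "y \<inter> y' = trivial_sf M" "sf_join M y y' = sets M"
    using B_complement[OF y] .
  have sub: "x \<in> sub_sigma_fields M" "y \<in> sub_sigma_fields M" "x \<inter> y \<in> sub_sigma_fields M"
    "y' \<in> sub_sigma_fields M"
    using x y y' B_Int by (auto intro: B_sub_sigma_fields)
  have "A \<in> sf_join M (x \<inter> y) (x \<inter> y')"
    using A B_split[OF y y'(1,3) x] by blast
  then have "A \<in> sf_join M (x \<inter> y) y'"
    using sf_join_mono[of "x \<inter> y" "x \<inter> y" "x \<inter> y'" y'] by blast
  then have "cond_prob_measurable y (x \<inter> y) (A \<inter> space M)"
    by (rule cond_prob_measurable_join[OF sub(2,4,3) Int_lower2 B_indep[OF y y'(1,2)] _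
          sub_sigma_fieldsD(7)[OF sub(4)]])
  moreover have "A \<inter> space M = A"
    using A sub_sigma_fieldsD(2)[OF sub(1)] sets.sets_into_space by blast
  ultimately show "cond_prob_measurable y x A"
    using cond_prob_measurable_mono[OF sub(3,1) Int_lower1] by simp
qed

text \<open>Commutation is carried through the induction because meets with \<open>y\<close>
  preserve increasing limits on its account. Keeping \<open>y\<close> general lets the lemma serve
  for \<open>y\<close> in \<open>B\<close> and then for \<open>y\<close> in
  \<open>Z\<close>.\<close>

lemma Z_Int_induct:
  assumes y: "y \<in> sub_sigma_fields M" and x: "x \<in> Z"
    and B: "\<And>b. b \<in> B \<Longrightarrow> sf_commute b y \<and> b \<inter> y \<in> Z"
  shows "sf_commute x y \<and> x \<inter> y \<in> Z"
  using x
proof induction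
  case (base x)
  then show ?case by (rule B)
next
  case (dec E)
  have sub: "E n \<in> sub_sigma_fields M" for n using dec(1) by (rule Z_sub_sigma_fields)
  have "sf_commute (\<Inter>n. E n) y"
    using sub dec(3) by (intro sf_commute_Inter) auto
  moreover have "(\<Inter>n. E n) \<inter> y = (\<Inter>n. E n \<inter> y)" by blast
  moreover have "decseq (\<lambda>n. E n \<inter> y)" using dec(2) unfolding decseq_def by blast
  then have "(\<Inter>n. E n \<inter> y) \<in> Z" using dec(3) by (intro monotone_closure.dec) auto
  ultimately show ?case by simp
next
  case (inc E)
  have sub: "E n \<in> sub_sigma_fields M" for n using inc(1) by (rule Z_sub_sigma_fields)
  have c: "sf_commute (E n) y" for n using inc(3) by blast
  have "incseq (\<lambda>n. E n \<inter> y)" using inc(2) unfolding incseq_def by blast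
  then have "sigma_sets (space M) (\<Union>n. E n \<inter> y) \<in> Z" using inc(3) by (intro monotone_closure.inc) auto
  then show ?case
    using sf_commute_incseq[OF inc(2) sub y c] incseq_Int[OF inc(2) sub y c] by simp
qed

text \<open>Two inductions: first one argument stays in \<open>B\<close> while the other runs
  through \<open>Z\<close>; symmetry of commutation then gives the base case for the remaining
  argument.\<close>

lemma Z_commute_Int:
  assumes x: "x \<in> Z" and y: "y \<in> Z"
  shows "sf_commute x y \<and> x \<inter> y \<in> Z"
proof (rule Z_Int_induct[OF Z_sub_sigma_fields[OF y] x])
  fix b assume b: "b \<in> B"
  have "sf_commute y b \<and> y \<inter> b \<in> Z"
    by (rule Z_Int_induct[OF B_sub_sigma_fields[OF b] y])
      (use B_commute B_Int b monotone_closure.base in blast)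
  then show "sf_commute b y \<and> b \<inter> y \<in> Z"
    using sf_commute_sym[OF Z_sub_sigma_fields[OF y] B_sub_sigma_fields[OF b]]
    by (simp add: Int_commute)
qed

lemma Z_Int: "x \<in> Z \<Longrightarrow> y \<in> Z \<Longrightarrow> x \<inter> y \<in> Z"
  using Z_commute_Int by blast

lemma Z_indep: "x \<in> Z \<Longrightarrow> y \<in> Z \<Longrightarrow> x \<inter> y = trivial_sf M \<Longrightarrow> indep_set x y"
  using Z_commute_Int sf_commute_indep_set Z_sub_sigma_fields by blast

section \<open>Complementary pairs\<close>

definition complementary :: "'a set set \<Rightarrow> 'a set set \<Rightarrow> bool" where
  "complementary x y \<longleftrightarrow> x \<in> Z \<and> y \<in> Z \<and> x \<inter> y = trivial_sf M \<and> sf_join M x y = sets M"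

lemma complementary_sym: "complementary x y \<Longrightarrow> complementary y x"
  by (auto simp: complementary_def Int_commute sf_join_commute)

lemma complementaryD:
  assumes "complementary x y"
  shows "x \<in> Z" "y \<in> Z" "x \<in> sub_sigma_fields M" "y \<in> sub_sigma_fields M"
    "x \<inter> y = trivial_sf M" "sf_join M x y = sets M" "indep_set x y"
  using assms Z_indep Z_sub_sigma_fields by (auto simp: complementary_def)

text \<open>The splitting of members of \<open>B\<close> is left as a premise because it has two
  sources: distributivity if \<open>x\<close> and \<open>y\<close> lie in \<open>B\<close>, and the
  argument of \<open>complementary_split\<close> in general.\<close>

lemma Z_split_induct:
  assumes c: "complementary x y"
    and B: "\<And>b. b \<in> B \<Longrightarrow> b \<subseteq> sf_join M (b \<inter> x) (b \<inter> y)" and z: "z \<in> Z"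
  shows "z \<subseteq> sf_join M (z \<inter> x) (z \<inter> y)"
  using z
proof induction
  case (base b)
  then show ?case by (rule B)
next
  case (dec E)
  note D = complementaryD[OF c]
  have sub: "E n \<inter> x \<in> sub_sigma_fields M" "E n \<inter> y \<in> sub_sigma_fields M" for n
    using Z_sub_sigma_fields Z_Int dec(1) D(1,2) by blast+
  let ?E = "\<Inter>n. E n"
  have Ex: "?E \<inter> x \<in> sub_sigma_fields M"
    using Z_sub_sigma_fields Z_Int monotone_closure.dec[OF dec(1,2)] D(1) by blast
  \<comment> \<open>Separate indices allow the two sides of the join to be sent to their limits one
    after the other.\<close>
  have mn: "?E \<subseteq> sf_join M (E n \<inter> x) (E m \<inter> y)" for n m
  proof -
    have "?E \<subseteq> E (max n m)" by blast
    also have "\<dots> \<subseteq> sf_join M (E (max n m) \<inter> x) (E (max n m) \<inter> y)" by (rule dec(3))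
    also have "\<dots> \<subseteq> sf_join M (E n \<inter> x) (E m \<inter> y)"
      using decseqD[OF dec(2), of n "max n m"] decseqD[OF dec(2), of m "max n m"]
      by (intro sf_join_mono) auto
    finally show ?thesis .
  qed
  \<comment> \<open>First limit: all \<open>E n \<inter> x\<close> lie in \<open>x\<close>, which is
    independent of the fixed \<open>E m \<inter> y\<close>.\<close>
  have Em: "?E \<subseteq> sf_join M (?E \<inter> x) (E m \<inter> y)" for m
  proof -
    have "?E \<subseteq> (\<Inter>n. sf_join M (E n \<inter> x) (E m \<inter> y))" using mn by (rule INT_greatest)
    also have "\<dots> \<subseteq> sf_join M (\<Inter>n. E n \<inter> x) (E m \<inter> y)"
      by (rule INT_sf_join_subset[OF D(3) sub(2) indep_set_mono[OF D(7) order_refl Int_lower2] _ sub(1) Int_lower2]) simp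
    also have "(\<Inter>n. E n \<inter> x) = ?E \<inter> x" by blast
    finally show ?thesis .
  qed
  \<comment> \<open>Second limit, with the roles of \<open>x\<close> and \<open>y\<close>
    exchanged.\<close>
  have "?E \<subseteq> (\<Inter>m. sf_join M (E m \<inter> y) (?E \<inter> x))"
    using Em unfolding sf_join_commute[of "?E \<inter> x"] by (rule INT_greatest)
  also have "\<dots> \<subseteq> sf_join M (\<Inter>m. E m \<inter> y) (?E \<inter> x)"
    by (rule INT_sf_join_subset[OF D(4) Ex indep_set_mono[OF indep_set_sym[OF D(7)] order_refl Int_lower2] _ sub(2) Int_lower2]) simp
  also have "(\<Inter>m. E m \<inter> y) = ?E \<inter> y" by blast
  finally show ?case by (simp only: sf_join_commute)
next
  case (inc E)
  let ?E = "sigma_sets (space M) (\<Union>n. E n)"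
  have E: "E n \<subseteq> ?E" for n by auto
  have "?E \<in> Z" using monotone_closure.inc[OF inc(1,2)] .
  then have J: "sf_join M (?E \<inter> x) (?E \<inter> y) \<in> sub_sigma_fields M"
    using complementaryD[OF c] Z_Int Z_sub_sigma_fields sf_join_sub_sigma_fields by meson
  have "E n \<subseteq> sf_join M (?E \<inter> x) (?E \<inter> y)" for n
  proof -
    have "sf_join M (E n \<inter> x) (E n \<inter> y) \<subseteq> sf_join M (?E \<inter> x) (?E \<inter> y)"
      using E[of n] by (intro sf_join_mono) blast+
    with inc(3)[of n] show ?thesis by (rule subset_trans)
  qed
  then show ?case
    by (intro sigma_algebra.sigma_sets_subset[OF sub_sigma_fieldsD(1)[OF J]] UN_least)
qed

text \<open>To split \<open>b\<close> in \<open>B\<close> along \<open>x\<close> and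
  \<open>y\<close>, first split \<open>x\<close> and \<open>y\<close> along \<open>b\<close> and its
  complement \<open>b'\<close>, which is known from distributivity in \<open>B\<close>. Then
  \<open>x\<close> and \<open>y\<close>, hence the whole sigma-field, lie in the join of
  \<open>u\<close> and \<open>b'\<close>, where \<open>u\<close> is the candidate for
  \<open>b\<close>; intersecting with \<open>b\<close> removes the independent
  \<open>b'\<close>.\<close>

lemma complementary_split:
  assumes c: "complementary x y" and z: "z \<in> Z"
  shows "z \<subseteq> sf_join M (z \<inter> x) (z \<inter> y)"
proof (rule Z_split_induct[OF c _ z])
  note D = complementaryD[OF c]
  fix b assume b: "b \<in> B"
  obtain b' where b': "b' \<in> B" "b \<inter> b' = trivial_sf M" "sf_join M b b' = sets M"
    using B_complement[OF b] .
  have cb: "complementary b b'"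
    using b b' monotone_closure.base by (auto simp: complementary_def)
  note Db = complementaryD[OF cb]
  have split: "w \<subseteq> sf_join M (w \<inter> b) (w \<inter> b')" if "w \<in> Z" for w
    using Z_split_induct[OF cb _ that] B_split[OF b b'(1,3)] by blast
  define u where "u = sf_join M (b \<inter> x) (b \<inter> y)"
  have u: "u \<in> sub_sigma_fields M"
    unfolding u_def using Z_Int Db(1) D(1,2) by (intro sf_join_sub_sigma_fields Z_sub_sigma_fields) auto
  have ub: "u \<subseteq> b" unfolding u_def by (intro sf_join_least Db(3)) auto
  have J: "sf_join M u b' \<in> sub_sigma_fields M" by (rule sf_join_sub_sigma_fields[OF u Db(4)])
  have part: "w \<subseteq> sf_join M u b'" if "w \<in> Z" "w = x \<or> w = y" for w
  proof -
    have "w \<inter> b \<subseteq> u" unfolding u_def using that(2) sf_join_upper[of "b \<inter> x" "b \<inter> y"] sf_join_upper[of "b \<inter> y" "b \<inter> x"] by blast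
    then have "sf_join M (w \<inter> b) (w \<inter> b') \<subseteq> sf_join M u b'" by (intro sf_join_mono) auto
    with split[OF that(1)] show ?thesis by (rule subset_trans)
  qed
  have "sf_join M x y \<subseteq> sf_join M u b'"
    using part D(1,2) by (intro sf_join_least[OF J]) auto
  then have "b \<subseteq> b \<inter> sf_join M u b'"
    using D(6) sub_sigma_fieldsD(2)[OF Db(3)] by blast
  also have "\<dots> \<subseteq> u"
    by (rule Int_sf_join_subset[OF Db(3,4,7) u ub])
  finally show "b \<subseteq> sf_join M (b \<inter> x) (b \<inter> y)" unfolding u_def .
qed

text \<open>The part of \<open>y\<close> inside \<open>x\<close> is absorbed by \<open>x\<close>.
  What remains is a join of independent sigma-fields, to which the results on such joins
  apply.\<close>

lemma sf_join_complementary: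
  assumes c: "complementary x x'" and y: "y \<in> Z"
  shows "sf_join M x y = sf_join M (x' \<inter> y) x"
proof
  note D = complementaryD[OF c]
  have J: "sf_join M (x' \<inter> y) x \<in> sub_sigma_fields M"
    using D y Z_Int by (intro sf_join_sub_sigma_fields Z_sub_sigma_fields) auto
  have "sf_join M (y \<inter> x) (y \<inter> x') \<subseteq> sf_join M x (x' \<inter> y)" by (intro sf_join_mono) auto
  with complementary_split[OF c y] have "y \<subseteq> sf_join M (x' \<inter> y) x"
    unfolding sf_join_commute[of "x' \<inter> y"] by (rule subset_trans)
  then show "sf_join M x y \<subseteq> sf_join M (x' \<inter> y) x"
    using sf_join_upper by (intro sf_join_least[OF J]) auto
  show "sf_join M (x' \<inter> y) x \<subseteq> sf_join M x y"
    unfolding sf_join_commute[of x] by (intro sf_join_mono) auto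
qed

text \<open>The base case is a premise so that the induction can be run twice, first with a member
  of \<open>B\<close> as the fixed complemented element.\<close>

lemma Z_join_induct:
  assumes c: "complementary x x'" and B: "\<And>b. b \<in> B \<Longrightarrow> sf_join M x b \<in> Z" and y: "y \<in> Z"
  shows "sf_join M x y \<in> Z"
  using y
proof induction
  case (base b)
  then show ?case by (rule B)
next
  case (dec E)
  note D = complementaryD[OF c]
  let ?E = "\<Inter>n. E n"
  have "?E \<in> Z" using monotone_closure.dec[OF dec(1,2)] .
  have sub: "x' \<inter> E n \<in> sub_sigma_fields M" for n
    using Z_sub_sigma_fields Z_Int dec(1) D(2) by blast
  \<comment> \<open>Rewriting each join with \<open>x' \<inter> E n\<close> in place of
    \<open>E n\<close> confines the decreasing parts to \<open>x'\<close>, which is independent of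
    \<open>x\<close>.\<close>
  have "sf_join M x ?E = (\<Inter>n. sf_join M x (E n))"
  proof
    show "sf_join M x ?E \<subseteq> (\<Inter>n. sf_join M x (E n))"
      by (intro INT_greatest sf_join_mono) auto
    have "(\<Inter>n. sf_join M x (E n)) = (\<Inter>n. sf_join M (x' \<inter> E n) x)"
      using sf_join_complementary[OF c dec(1)] by simp
    also have "\<dots> \<subseteq> sf_join M (\<Inter>n. x' \<inter> E n) x"
      by (rule INT_sf_join_subset[OF D(4,3) indep_set_sym[OF D(7)] _ sub Int_lower1]) simp
    also have "(\<Inter>n. x' \<inter> E n) = x' \<inter> ?E" by blast
    also have "sf_join M (x' \<inter> ?E) x = sf_join M x ?E"
      using sf_join_complementary[OF c \<open>?E \<in> Z\<close>] by simp
    finally show "(\<Inter>n. sf_join M x (E n)) \<subseteq> sf_join M x ?E" .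
  qed
  moreover have "decseq (\<lambda>n. sf_join M x (E n))"
    unfolding decseq_def using decseqD[OF dec(2)] by (intro allI impI sf_join_mono) auto
  ultimately show ?case using monotone_closure.dec[OF dec(3)] by simp
next
  case (inc E)
  note D = complementaryD[OF c]
  let ?E = "sigma_sets (space M) (\<Union>n. E n)" and ?J = "sigma_sets (space M) (\<Union>n. sf_join M x (E n))"
  have "incseq (\<lambda>n. sf_join M x (E n))"
    unfolding incseq_def using incseqD[OF inc(2)] by (intro allI impI sf_join_mono) auto
  then have JZ: "?J \<in> Z" using monotone_closure.inc[OF inc(3)] by simp
  have EZ: "?E \<in> Z" using monotone_closure.inc[OF inc(1,2)] .
  have J: "sf_join M x (E n) \<subseteq> ?J" for n by auto
  have E: "E n \<subseteq> ?E" for n by auto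
  have "sf_join M x ?E = ?J"
  proof
    have "E n \<subseteq> ?J" for n using sf_join_upper(2)[of "E n" x] J[of n] by blast
    then have "?E \<subseteq> ?J"
      by (intro sigma_algebra.sigma_sets_subset[OF sub_sigma_fieldsD(1)[OF Z_sub_sigma_fields[OF JZ]]] UN_least)
    moreover have "x \<subseteq> ?J" using sf_join_upper(1)[of x "E 0"] J[of 0] by blast
    ultimately show "sf_join M x ?E \<subseteq> ?J"
      by (intro sf_join_least Z_sub_sigma_fields[OF JZ])
    have sub: "sf_join M x ?E \<in> sub_sigma_fields M"
      by (rule sf_join_sub_sigma_fields[OF D(3) Z_sub_sigma_fields[OF EZ]])
    show "?J \<subseteq> sf_join M x ?E"
      by (intro sigma_algebra.sigma_sets_subset[OF sub_sigma_fieldsD(1)[OF sub]] UN_least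
          sf_join_mono order_refl E)
  qed
  with JZ show ?case by simp
qed

text \<open>Members of \<open>B\<close> are complemented, so an induction over \<open>x\<close> with
  \<open>b\<close> fixed gives the base case for the induction over \<open>y\<close>.\<close>

lemma complementary_join_Z:
  assumes c: "complementary x x'" and y: "y \<in> Z"
  shows "sf_join M x y \<in> Z"
proof (rule Z_join_induct[OF c _ y])
  fix b assume b: "b \<in> B"
  obtain b' where b': "b' \<in> B" "b \<inter> b' = trivial_sf M" "sf_join M b b' = sets M"
    using B_complement[OF b] .
  have cb: "complementary b b'"
    using b b' monotone_closure.base by (auto simp: complementary_def)
  have "sf_join M b x \<in> Z"
    by (rule Z_join_induct[OF cb _ complementaryD(1)[OF c]]) (use b B_join monotone_closure.base in blast)
  then show "sf_join M x b \<in> Z" by (simp only: sf_join_commute)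
qed

text \<open>De Morgan's law. The meet is trivial because \<open>x'\<close> meets the join of
  \<open>x\<close> and \<open>y\<close> only inside \<open>y\<close>; the join is everything because
  it contains \<open>x\<close> and both parts of \<open>x'\<close> along \<open>y\<close> and
  \<open>y'\<close>.\<close>

lemma complementary_join:
  assumes x: "complementary x x'" and y: "complementary y y'"
  shows "complementary (sf_join M x y) (x' \<inter> y')"
  unfolding complementary_def
proof (intro conjI)
  note Dx = complementaryD[OF x] and Dy = complementaryD[OF y]
  show 1: "sf_join M x y \<in> Z" using complementary_join_Z[OF x Dy(1)] .
  show 2: "x' \<inter> y' \<in> Z" using Z_Int Dx Dy by blast
  note sub = 1[THEN Z_sub_sigma_fields] 2[THEN Z_sub_sigma_fields]
  have "x' \<inter> sf_join M (x' \<inter> y) x \<subseteq> x' \<inter> y"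
    using Z_Int[OF Dx(2) Dy(1)]
    by (intro Int_sf_join_subset[OF Dx(4,3) indep_set_sym[OF Dx(7)]] Z_sub_sigma_fields) auto
  then have "sf_join M x y \<inter> (x' \<inter> y') \<subseteq> y \<inter> y'"
    unfolding sf_join_complementary[OF x Dy(1)] by blast
  then show "sf_join M x y \<inter> (x' \<inter> y') = trivial_sf M"
    using trivial_sf_subset[OF sub(1)] trivial_sf_subset[OF sub(2)] Dy(5) by blast
  have J: "sf_join M (sf_join M x y) (x' \<inter> y') \<in> sub_sigma_fields M"
    by (rule sf_join_sub_sigma_fields[OF sub])
  show "sf_join M (sf_join M x y) (x' \<inter> y') = sets M"
  proof
    show "sf_join M (sf_join M x y) (x' \<inter> y') \<subseteq> sets M" by (rule sub_sigma_fieldsD(2)[OF J])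
    have "x' \<inter> y \<subseteq> sf_join M x y" using sf_join_upper(2)[of y x] by blast
    then have "sf_join M (x' \<inter> y) (x' \<inter> y') \<subseteq> sf_join M (sf_join M x y) (x' \<inter> y')"
      by (intro sf_join_mono) auto
    with complementary_split[OF y Dx(2)] have "x' \<subseteq> sf_join M (sf_join M x y) (x' \<inter> y')"
      by (rule subset_trans)
    moreover have "x \<subseteq> sf_join M (sf_join M x y) (x' \<inter> y')"
      using sf_join_upper(1)[of x y] sf_join_upper(1)[of "sf_join M x y" "x' \<inter> y'"] by (rule subset_trans)
    ultimately have "sf_join M x x' \<subseteq> sf_join M (sf_join M x y) (x' \<inter> y')"
      by (intro sf_join_least[OF J])
    then show "sets M \<subseteq> sf_join M (sf_join M x y) (x' \<inter> y')" using Dx(6) by simp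
  qed
qed

section \<open>The completion\<close>

definition complemented :: "'a set set set" where
  "complemented = {x. \<exists>y. complementary x y}"

text \<open>Split the left-hand side along \<open>f\<close> and \<open>f'\<close>: its part in
  \<open>f\<close> lies in \<open>e \<inter> f\<close>, and its part in \<open>f'\<close> lies in
  \<open>e \<inter> g\<close> because \<open>f'\<close> meets the join of \<open>f\<close> and
  \<open>g\<close> only inside \<open>g\<close>.\<close>

lemma complemented_distrib:
  assumes e: "e \<in> Z" and f: "complementary f f'" and g: "g \<in> Z"
  shows "e \<inter> sf_join M f g = sf_join M (e \<inter> f) (e \<inter> g)"
proof
  note D = complementaryD[OF f]
  have fg: "sf_join M f g \<in> Z" by (rule complementary_join_Z[OF f g])
  let ?z = "e \<inter> sf_join M f g"
  have z: "?z \<in> Z" using Z_Int e fg by blast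
  have "f' \<inter> sf_join M (f' \<inter> g) f \<subseteq> f' \<inter> g"
    using Z_Int[OF D(2) g]
    by (intro Int_sf_join_subset[OF D(4,3) indep_set_sym[OF D(7)]] Z_sub_sigma_fields) auto
  then have "?z \<inter> f' \<subseteq> e \<inter> g"
    unfolding sf_join_complementary[OF f g] by blast
  then have "sf_join M (?z \<inter> f) (?z \<inter> f') \<subseteq> sf_join M (e \<inter> f) (e \<inter> g)"
    by (intro sf_join_mono) auto
  with complementary_split[OF f z] show "?z \<subseteq> sf_join M (e \<inter> f) (e \<inter> g)"
    by (rule subset_trans)
  have "e \<inter> f \<subseteq> ?z" "e \<inter> g \<subseteq> ?z"
    using sf_join_upper(1)[of f g] sf_join_upper(2)[of g f] by blast+
  then show "sf_join M (e \<inter> f) (e \<inter> g) \<subseteq> ?z"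
    by (rule sf_join_least[OF Z_sub_sigma_fields[OF z]])
qed

text \<open>A complement within \<open>D\<close> is a complement within \<open>Z\<close>. This gives
  maximality of the completion and, with \<open>B\<close> as \<open>D\<close>, that it contains
  \<open>B\<close>.\<close>

lemma complemented_if_noise:
  assumes D: "noise_type_boolean_algebra M D" "D \<subseteq> Z" and x: "x \<in> D"
  shows "x \<in> complemented"
proof -
  obtain y where "y \<in> D" "x \<inter> y = trivial_sf M" "sf_join M x y = sets M"
    using noise_type_boolean_algebraD(7)[OF D(1)] x by blast
  then show ?thesis using D(2) x by (auto simp: complemented_def complementary_def)
qed

lemma B_subset_Z: "B \<subseteq> Z"
  using monotone_closure.base by blast

lemma noise_complemented: "noise_type_boolean_algebra M complemented"
  unfolding noise_type_boolean_algebra_def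
proof (intro conjI ballI impI)
  show "complemented \<subseteq> sub_sigma_fields M"
    using complementaryD(3) by (auto simp: complemented_def)
  show "trivial_sf M \<in> complemented" "sets M \<in> complemented"
    using complemented_if_noise[OF noise B_subset_Z] noise_type_boolean_algebraD(2,3)[OF noise] by blast+
  fix e f assume "e \<in> complemented" "f \<in> complemented"
  then obtain e' f' where e: "complementary e e'" and f: "complementary f f'"
    by (auto simp: complemented_def)
  show "sf_join M e f \<in> complemented"
    using complementary_join[OF e f] by (auto simp: complemented_def)
  \<comment> \<open>The join of \<open>e'\<close> and \<open>f'\<close> is a complement.\<close>
  show "e \<inter> f \<in> complemented"
    using complementary_sym[OF complementary_join[OF complementary_sym[OF e] complementary_sym[OF f]]]
    by (auto simp: complemented_def)
  show "indep_set e f" if "e \<inter> f = trivial_sf M"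
    using Z_indep complementaryD(1)[OF e] complementaryD(1)[OF f] that by blast
  show "e \<inter> sf_join M f g = sf_join M (e \<inter> f) (e \<inter> g)" if "g \<in> complemented" for g
    using that complemented_distrib[OF complementaryD(1)[OF e] f] complementaryD(1)
    by (auto simp: complemented_def)
next
  fix e assume "e \<in> complemented"
  then obtain e' where e: "complementary e e'" by (auto simp: complemented_def)
  then have "e' \<in> complemented" using complementary_sym by (auto simp: complemented_def)
  then show "\<exists>f\<in>complemented. e \<inter> f = trivial_sf M \<and> sf_join M e f = sets M"
    using complementaryD(5,6)[OF e] by blast
qed

lemma noise_type_completion_complemented: "noise_type_completion M B complemented"
  unfolding noise_type_completion_def monotonically_dense_extensions_def
proof (intro conjI ballI CollectI)
  show "noise_type_boolean_algebra M complemented" by (rule noise_complemented)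
  show "B \<subseteq> complemented" using complemented_if_noise[OF noise B_subset_Z] by blast
  show "monotonically_dense M B complemented"
    unfolding monotonically_dense_iff using complementaryD(1) by (auto simp: complemented_def)
  show "D \<subseteq> complemented"
    if "D \<in> {C. noise_type_boolean_algebra M C \<and> B \<subseteq> C \<and> monotonically_dense M B C}" for D
    using that complemented_if_noise[of D] monotonically_dense_iff by blast
qed

end

theorem theorem1:
  fixes M :: "'a measure" and B :: "'a set set set"
  assumes "prob_space M"
    and "separable_L2 M"
    and "noise_type_boolean_algebra M B"
  shows "\<exists>C. noise_type_completion M B C"
proof -
  interpret noise_boolean_algebra M B
    using assms(1,3) by (simp add: noise_boolean_algebra_def noise_boolean_algebra_axioms_def)
  show ?thesis using noise_type_completion_complemented by blast
qed

end
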